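(* Let $n\ge 2$ be an even integer, let $\mathcal{A}$ be a unital algebra over a commutative unital ring $\mathcal{R}$ with a nontrivial idempotent $e$, and put $f=1-e$. Suppose that $\mathcal{A}$ is $2$- and $(n-1)$-torsion free, and that for each $x\in\mathcal{A}$: $exe\cdot e\mathcal{A}f=\{0\}=f\mathcal{A}e\cdot exe$ implies $exe=0$, and $e\mathcal{A}f\cdot fxf=\{0\}=fxf\cdot f\mathcal{A}e$ implies $fxf=0$. Suppose that one of the following statements holds: (i-1) $e\mathcal{A}e=\mathcal{S}(e\mathcal{A}e)$ and $f\mathcal{A}f=\mathcal{S}(f\mathcal{A}f)$; (i-2) $e\mathcal{A}e=\mathcal{S}(e\mathcal{A}e)$ and $\mathcal{Z}(e\mathcal{A}e)=e\mathcal{Z}(\mathcal{A})e$; (i-3) $f\mathcal{A}f=\mathcal{S}(f\mathcal{A}f)$ and $\mathcal{Z}(f\mathcal{A}f)=f\mathcal{Z}(\mathcal{A})f$; (i-4) $\mathcal{Z}(e\mathcal{A}e)=e\mathcal{Z}(\mathcal{A})e$ and $\mathcal{Z}(f\mathcal{A}f)=f\mathcal{Z}(\mathcal{A})f$, and, when $n\ge 3$, $e\mathcal{A}e$ or $f\mathcal{A}f$ satisfies property (P) (defined in the context); and that one of the following statements also holds: (ii-1) $e\mathcal{A}e$ or $f\mathcal{A}f$ has no nonzero central ideal; (ii-2) $\mathcal{Z}(\mathcal{A})=\{a+b : a\in e\mathcal{Z}(\mathcal{A})e,\ b\in f\mathcal{Z}(\mathcal{A})f,\ am_0=m_0b\}$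 for some $m_0\in e\mathcal{A}f$; (ii-3) $\mathcal{Z}(\mathcal{A})=\{a+b : a\in e\mathcal{Z}(\mathcal{A})e,\ b\in f\mathcal{Z}(\mathcal{A})f,\ t_0a=bt_0\}$ for some $t_0\in f\mathcal{A}e$; (ii-4) $e\mathcal{A}f\cdot f\mathcal{A}e=f\mathcal{A}e\cdot e\mathcal{A}f=\{0\}$. Then every Lie $n$-derivation on $\mathcal{A}$ is standard.
   Context: Linear means $\mathcal{R}$-linear; $\mathcal{Z}(\cdot)$ denotes the centre. Nontrivial idempotent: $e^2=e$, $e\ne 0,1$. For a positive integer $k$, $\mathcal{A}$ is $k$-torsion free if $kx=0$ implies $x=0$ for each $x\in\mathcal{A}$. $[x,y]=xy-yx$. Define $p_1(x_1)=x_1$ and $p_n(x_1,\dots,x_n)=[p_{n-1}(x_1,\dots,x_{n-1}),x_n]$ for $n\ge2$; for $n\ge 2$, $p_n(x_1,\dots,x_n)$ is called an $(n-1)$-th commutator. A linear map $\varphi:\mathcal{A}\to\mathcal{A}$ is a Lie $n$-derivation if $\varphi(p_n(x_1,\dots,x_n))=\sum_{i=1}^n p_n(x_1,\dots,x_{i-1},\varphi(x_i),x_{i+1},\dots,x_n)$ for all $x_1,\dots,x_n\in\mathcal{A}$. A Lie $n$-derivation is standard if it equals $h+\tau$ with $h$ a derivation on $\mathcal{A}$ (linear, $h(xy)=h(x)y+xh(y)$) and $\tau$ a linear mapping from $\mathcal{A}$ into $\mathcal{Z}(\mathcal{A})$ vanishing on all $(n-1)$-th commutators of $\mathcal{A}$.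 For an algebra $\mathcal{B}$, $\mathcal{S}(\mathcal{B})$ is the subalgebra of $\mathcal{B}$ generated by all idempotents and all commutators of $\mathcal{B}$; a central ideal of $\mathcal{B}$ is an ideal contained in $\mathcal{Z}(\mathcal{B})$; $\mathcal{B}$ satisfies property (P) if for each $x\in\mathcal{B}$, $[x,\mathcal{B}]\subseteq\mathcal{Z}(\mathcal{B})$ implies $x\in\mathcal{Z}(\mathcal{B})$. $e\mathcal{A}e$ and $f\mathcal{A}f$ are regarded as unital algebras with units $e$ and $f$. *)

theory Defs
  imports HOL.Modules
begin

text \<open>The classes \<open>comm_ring_1\<close> and \<open>ring_1\<close> require \<open>0 \<noteq> 1\<close>. This loses nothing for an algebra
  with a nontrivial idempotent: such an algebra is nonzero, hence so is its ring of scalars.\<close>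

locale unital_algebra = module scale
  for scale :: "'r::comm_ring_1 \<Rightarrow> 'a::ring_1 \<Rightarrow> 'a" +
  assumes scale_mult_left: "scale r x * y = scale r (x * y)"
    and scale_mult_right: "x * scale r y = scale r (x * y)"

definition torsion_free :: "nat \<Rightarrow> 'a::ring_1 itself \<Rightarrow> bool" where
  "torsion_free k _ \<longleftrightarrow> (\<forall>x::'a. of_nat k * x = 0 \<longrightarrow> x = 0)"

definition commutator :: "'a::ring \<Rightarrow> 'a \<Rightarrow> 'a" where
  "commutator x y = x * y - y * x"

text \<open>\<open>lie_poly n x\<close> is \<open>p\<^sub>n(x 1, \<dots>, x n)\<close>. It only looks at the entries \<open>1, \<dots>, n\<close> of the sequence
  \<open>x\<close>, and the value at \<open>n = 0\<close> is a dummy.\<close>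

fun lie_poly :: "nat \<Rightarrow> (nat \<Rightarrow> 'a::ring) \<Rightarrow> 'a" where
  "lie_poly 0 x = 0"
| "lie_poly (Suc 0) x = x 1"
| "lie_poly (Suc (Suc n)) x = commutator (lie_poly (Suc n) x) (x (Suc (Suc n)))"

definition lie_n_derivation :: "('r::comm_ring_1 \<Rightarrow> 'a::ring_1 \<Rightarrow> 'a) \<Rightarrow> nat \<Rightarrow> ('a \<Rightarrow> 'a) \<Rightarrow> bool" where
  "lie_n_derivation scale n \<phi> \<longleftrightarrow> module_hom scale scale \<phi> \<and>
     (\<forall>x. \<phi> (lie_poly n x) = (\<Sum>i=1..n. lie_poly n (x(i := \<phi> (x i)))))"

definition derivation :: "('r::comm_ring_1 \<Rightarrow> 'a::ring_1 \<Rightarrow> 'a) \<Rightarrow> ('a \<Rightarrow> 'a) \<Rightarrow> bool" where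
  "derivation scale h \<longleftrightarrow> module_hom scale scale h \<and> (\<forall>x y. h (x * y) = h x * y + x * h y)"

text \<open>Subalgebras of the ambient algebra, such as the corner \<open>e\<A>e\<close>, are represented by their
  carrier sets \<open>B\<close>; the unit of \<open>B\<close> need not be \<open>1\<close>.\<close>

definition centre :: "'a::ring set \<Rightarrow> 'a set" where
  "centre B = {z \<in> B. \<forall>x\<in>B. z * x = x * z}"

definition standard_lie_n_derivation ::
    "('r::comm_ring_1 \<Rightarrow> 'a::ring_1 \<Rightarrow> 'a) \<Rightarrow> nat \<Rightarrow> ('a \<Rightarrow> 'a) \<Rightarrow> bool" where
  "standard_lie_n_derivation scale n \<phi> \<longleftrightarrow>
     (\<exists>h \<tau>. derivation scale h \<and> module_hom scale scale \<tau> \<and> range \<tau> \<subseteq> centre UNIV \<and>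
        (\<forall>x. \<tau> (lie_poly n x) = 0) \<and> (\<forall>x. \<phi> x = h x + \<tau> x))"

definition peirce :: "'a::ring \<Rightarrow> 'a \<Rightarrow> 'a set" where
  "peirce e f = {e * x * f | x. True}"

definition subalgebra :: "('r::comm_ring_1 \<Rightarrow> 'a::ring_1 \<Rightarrow> 'a) \<Rightarrow> 'a set \<Rightarrow> bool" where
  "subalgebra scale T \<longleftrightarrow> module.subspace scale T \<and> (\<forall>x\<in>T. \<forall>y\<in>T. x * y \<in> T)"

text \<open>No unit is demanded of a subalgebra, but the unit of \<open>B\<close> is one of the idempotents below, so
  \<open>alg_S scale B\<close> is a unital subalgebra of \<open>B\<close>.\<close>

definition alg_S :: "('r::comm_ring_1 \<Rightarrow> 'a::ring_1 \<Rightarrow> 'a) \<Rightarrow> 'a set \<Rightarrow> 'a set" where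
  "alg_S scale B =
     subalgebra scale hull ({x \<in> B. x * x = x} \<union> {commutator x y | x y. x \<in> B \<and> y \<in> B})"

definition central_ideal :: "('r::comm_ring_1 \<Rightarrow> 'a::ring_1 \<Rightarrow> 'a) \<Rightarrow> 'a set \<Rightarrow> 'a set \<Rightarrow> bool" where
  "central_ideal scale B I \<longleftrightarrow> module.subspace scale I \<and>
     (\<forall>x\<in>I. \<forall>b\<in>B. b * x \<in> I \<and> x * b \<in> I) \<and> I \<subseteq> centre B"

definition property_P :: "'a::ring set \<Rightarrow> bool" where
  "property_P B \<longleftrightarrow> (\<forall>x\<in>B. (\<forall>y\<in>B. commutator x y \<in> centre B) \<longrightarrow> x \<in> centre B)"

end

theory Submission
  imports Defs
begin

text \<open>
  Write \<open>M = e\<A>f\<close>, \<open>T = f\<A>e\<close> and let the diagonal part of \<open>\<A>\<close> be \<open>e\<A>e + f\<A>f\<close>, the centralizer of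
  \<open>e\<close>. Four ideas prove the theorem.

  \<^item> Subtracting an inner derivation from the given map makes \<open>\<delta> e\<close> diagonal. An element \<open>w\<close>
  of \<open>M + T\<close> satisfies \<open>[[w, e], e] = w\<close>, so an iterated commutator can be padded with an even number of
  \<open>e\<close>s without changing its value. Since \<open>n\<close> is even, this gives
  \<open>\<delta> [w, e] = [\<delta> w, e] + (n - 1) [w, \<delta> e]\<close> (\<open>leibniz_off_diagonal\<close>). Comparing Peirce components and
  using the two torsion hypotheses, \<open>\<delta>\<close> preserves \<open>M\<close> and \<open>T\<close> and \<open>\<delta> e\<close> is central. After that, the
  padding turns the identity of length \<open>n\<close> into the usual Lie derivation identity for commutators of a
  diagonal element with one of \<open>M\<close> or \<open>T\<close>, and of \<open>M\<close> with \<open>T\<close> (\<open>peirce_lie_map\<close>). The next two steps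
  use only this, apart from one remark on \<open>n = 2\<close>.

  \<^item> A diagonal element that commutes with \<open>M\<close> and \<open>T\<close> is central, by faithfulness
  (\<open>diag_central\<close>). Hence, by the Jacobi identity, \<open>\<delta>\<close> is a Lie derivation modulo the centre on the
  diagonal, too. The first group of hypotheses serves to show that each \<open>a\<close> in a corner \<open>e\<A>e\<close> or
  \<open>f\<A>f\<close> \<^emph>\<open>splits\<close>: \<open>\<delta> a\<close> lies in the same corner up to a central element. Idempotents and commutators
  always split and products of splitting elements split (\<open>splits_of_alg_S\<close>); and the relation
  \<open>[\<delta> a, b] + [a, \<delta> b] \<in> \<Z>(\<A>)\<close> for \<open>a\<close> and \<open>b\<close> in different corners carries information from one
  corner to the other (\<open>corners_split\<close>).

  \<^item> When all elements of the corners split, \<open>\<delta> = h + \<tau>\<close> with \<open>\<tau>\<close> linear and central-valued and \<open>h\<close>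
  preserving all four Peirce components. The failure \<open>h (x y) - h x y - x h y\<close> of \<open>h\<close> to be a
  derivation is a Hochschild cocycle, and the cocycle identity shows that it vanishes except
  possibly on \<open>M \<times> T\<close> and \<open>T \<times> M\<close>, where it satisfies strong identities (\<open>defect_ideal\<close>,
  \<open>defect_assoc\<close>, \<open>defect_alternating\<close>). Each of the second group of hypotheses makes these remaining
  values vanish (\<open>derivation_of_centre_conditions\<close>).

  \<^item> The map \<open>\<tau>\<close>, as a difference of two Lie \<open>n\<close>-derivations, is one itself; its values being central,
  the Leibniz sum vanishes, and so \<open>\<tau>\<close> kills the \<open>(n - 1)\<close>-th commutators.

  All intermediate notions are symmetric in \<open>e\<close> and \<open>f\<close>; most lemmas are stated for one of the two
  corners, and the lemmas \<open>swap\<close>, \<open>swap_map\<close> and \<open>swap_derivation\<close> supply the other.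
\<close>

section \<open>Leibniz sums of iterated commutators\<close>

lemma centre_UNIV_iff: "z \<in> centre UNIV \<longleftrightarrow> (\<forall>x. z * x = x * z)"
  by (simp add: centre_def)

lemma centre_commute: "z \<in> centre UNIV \<Longrightarrow> z * x = x * z"
  by (simp add: centre_UNIV_iff)

lemma centre_commutator:
  assumes "z \<in> centre UNIV"
  shows "commutator z x = 0" "commutator x z = 0"
  using centre_commute[OF assms] by (simp_all add: commutator_def)

lemma centre_zero: "0 \<in> centre (UNIV :: 'a::ring set)"
  by (simp add: centre_UNIV_iff)

lemma centre_add: "z \<in> centre UNIV \<Longrightarrow> w \<in> centre UNIV \<Longrightarrow> z + w \<in> centre UNIV"
  by (simp add: centre_UNIV_iff algebra_simps)

lemma centre_diff: "z \<in> centre UNIV \<Longrightarrow> w \<in> centre UNIV \<Longrightarrow> z - w \<in> centre UNIV"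
  by (simp add: centre_UNIV_iff algebra_simps)

lemma centre_uminus: "z \<in> centre UNIV \<Longrightarrow> - z \<in> centre UNIV"
  by (simp add: centre_UNIV_iff)

lemma commutator_simps:
  "commutator (x + y) w = commutator x w + commutator y w"
  "commutator x (y + w) = commutator x y + commutator x w"
  "commutator (x - y) w = commutator x w - commutator y w"
  "commutator x (y - w) = commutator x y - commutator x w"
  "commutator (- x) w = - commutator x w"
  "commutator x (- w) = - commutator x w"
  "commutator 0 x = 0" "commutator x 0 = 0"
  by (simp_all add: commutator_def algebra_simps)

lemma commutator_jacobi:
  "commutator (commutator x y) w = commutator x (commutator y w) - commutator y (commutator x w)"
    by (simp add: commutator_def algebra_simps)

lemma neg_eq_iff: "- x = - y - w \<longleftrightarrow> x = y + w" for x y w :: "'a::ab_group_add"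
  by (metis add.commute minus_add_distrib minus_minus uminus_add_conv_diff)

lemma neg_eq_diff_iff: "- x = y - w \<longleftrightarrow> x = w - y" for x y w :: "'a::ab_group_add"
  by (metis minus_diff_eq minus_minus)

lemma commutator_sum_left: "commutator (sum g I) y = (\<Sum>i\<in>I. commutator (g i) y)"
  by (simp add: commutator_def sum_distrib_left sum_distrib_right sum_subtractf)

text \<open>The right-hand side of the identity that defines Lie \<open>n\<close>-derivations. It is studied for an
  arbitrary map, because the recursion \<open>leibniz_sum_Suc\<close> makes it computable and additive in the
  map.\<close>

definition leibniz_sum :: "('a::ring \<Rightarrow> 'a) \<Rightarrow> nat \<Rightarrow> (nat \<Rightarrow> 'a) \<Rightarrow> 'a" where
  "leibniz_sum \<delta> n x = (\<Sum>i=1..n. lie_poly n (x(i := \<delta> (x i))))"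

lemma lie_poly_cong:
  "(\<And>i. 1 \<le> i \<Longrightarrow> i \<le> n \<Longrightarrow> x i = y i) \<Longrightarrow> lie_poly n x = lie_poly n y"
  by (induction n x rule: lie_poly.induct) auto

lemma leibniz_sum_1: "leibniz_sum \<delta> (Suc 0) x = \<delta> (x 1)"
  by (simp add: leibniz_sum_def)

lemma leibniz_sum_Suc:
  "leibniz_sum \<delta> (Suc (Suc n)) x =
     commutator (leibniz_sum \<delta> (Suc n) x) (x (Suc (Suc n))) +
     commutator (lie_poly (Suc n) x) (\<delta> (x (Suc (Suc n))))"
proof -
  have "lie_poly (Suc n) (x(Suc (Suc n) := y)) = lie_poly (Suc n) x" for y
    by (rule lie_poly_cong) auto
  then show ?thesis
    by (simp add: leibniz_sum_def commutator_sum_left commutator_simps)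
qed

text \<open>Hence a difference of Lie \<open>n\<close>-derivations is a Lie \<open>n\<close>-derivation.\<close>

lemma leibniz_sum_diff:
  "leibniz_sum (\<lambda>y. g y - h y) (Suc k) x = leibniz_sum g (Suc k) x - leibniz_sum h (Suc k) x"
  by (induction k) (simp_all add: leibniz_sum_1 leibniz_sum_Suc commutator_simps)

lemma leibniz_sum_derivation:
  assumes diff: "\<And>x y. h (x - y) = h x - h y"
    and mult: "\<And>x y. h (x * y) = h x * y + x * h y"
  shows "leibniz_sum h (Suc k) x = h (lie_poly (Suc k) x)"
  by (induction k)
    (simp_all add: leibniz_sum_1 leibniz_sum_Suc commutator_def diff mult algebra_simps)

text \<open>Every summand has a central element in one of its \<open>n \<ge> 2\<close> places and is therefore zero. For a Lie
  \<open>n\<close>-derivation with central values this says that it vanishes on \<open>(n - 1)\<close>-th commutators.\<close>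

lemma leibniz_sum_central:
  assumes "\<And>x. \<tau> x \<in> centre UNIV"
  shows "leibniz_sum \<tau> (Suc (Suc k)) x = 0"
  by (induction k)
    (simp_all add: leibniz_sum_1 leibniz_sum_Suc centre_commutator assms commutator_simps)

text \<open>Padding with a constant \<open>c\<close> iterates \<open>y \<mapsto> [y, c]\<close>; by the lemma after this one, the Leibniz sum
  is padded in the same way when \<open>\<delta> c\<close> is central.\<close>

lemma lie_poly_tail:
  assumes "\<And>i. Suc j < i \<Longrightarrow> i \<le> Suc j + k \<Longrightarrow> s i = c"
  shows "lie_poly (Suc j + k) s = ((\<lambda>y. commutator y c) ^^ k) (lie_poly (Suc j) s)"
  using assms by (induction k) auto

lemma leibniz_sum_tail:
  assumes "\<And>i. Suc j < i \<Longrightarrow> i \<le> Suc j + k \<Longrightarrow> s i = c" and "\<delta> c \<in> centre UNIV"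
  shows "leibniz_sum \<delta> (Suc j + k) s = ((\<lambda>y. commutator y c) ^^ k) (leibniz_sum \<delta> (Suc j) s)"
  using assms by (induction k) (auto simp: leibniz_sum_Suc centre_commutator)

section \<open>Peirce decompositions with faithful corners\<close>

text \<open>For complementary idempotents this is \<open>e\<A>e + f\<A>f\<close>. Having no off-diagonal components is preferred to
  being a sum of two corner elements because it avoids existential quantifiers.\<close>

definition peirce_diag :: "'a::ring \<Rightarrow> 'a \<Rightarrow> 'a set" where
  "peirce_diag e f = {x. e * x * f = 0 \<and> f * x * e = 0}"

text \<open>The inner idempotents need not match, since \<open>p x q q' y r\<close> has the form \<open>p z r\<close> anyway.\<close>

lemma peirce_mult: "x \<in> peirce p q \<Longrightarrow> y \<in> peirce q' r \<Longrightarrow> x * y \<in> peirce p r"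
  unfolding peirce_def by (auto, metis mult.assoc)

lemma peirce_add: "x \<in> peirce p q \<Longrightarrow> y \<in> peirce p q \<Longrightarrow> x + y \<in> peirce p q"
  unfolding peirce_def by (auto, metis distrib_left distrib_right)

lemma peirce_diff: "x \<in> peirce p q \<Longrightarrow> y \<in> peirce p q \<Longrightarrow> x - y \<in> peirce p q"
  unfolding peirce_def by (auto, metis left_diff_distrib right_diff_distrib)

lemma peirce_zero: "0 \<in> peirce p q"
  unfolding peirce_def by (auto intro: exI[of _ 0])

lemma peirce_diag_commute: "peirce_diag f e = peirce_diag e f"
  by (auto simp: peirce_diag_def)

lemma (in unital_algebra) scale_peirce: "x \<in> peirce p q \<Longrightarrow> scale r x \<in> peirce p q"
proof -
  assume "x \<in> peirce p q"
  then obtain y where "x = p * y * q" by (auto simp: peirce_def)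
  then have "scale r x = p * scale r y * q" by (simp add: scale_mult_left scale_mult_right)
  then show ?thesis by (auto simp: peirce_def)
qed

lemma (in unital_algebra) scale_centre: "z \<in> centre UNIV \<Longrightarrow> scale r z \<in> centre UNIV"
  by (auto simp: centre_UNIV_iff scale_mult_left scale_mult_right)

locale faithful_peirce =
  fixes e f :: "'a::ring_1"
  assumes idem: "e * e = e" "f * f = f" "e * f = 0" "f * e = 0"
    and sum_one: "e + f = 1"
    and faithful_e: "\<And>a. a \<in> peirce e e \<Longrightarrow> (\<And>m. m \<in> peirce e f \<Longrightarrow> a * m = 0) \<Longrightarrow>
          (\<And>t. t \<in> peirce f e \<Longrightarrow> t * a = 0) \<Longrightarrow> a = 0"
    and faithful_f: "\<And>b. b \<in> peirce f f \<Longrightarrow> (\<And>t. t \<in> peirce f e \<Longrightarrow> b * t = 0) \<Longrightarrow>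
          (\<And>m. m \<in> peirce e f \<Longrightarrow> m * b = 0) \<Longrightarrow> b = 0"
begin

lemma swap: "faithful_peirce f e"
  using idem sum_one faithful_e faithful_f by unfold_locales (auto simp: add.commute)

lemma idem_assoc: "e * (e * x) = e * x" "f * (f * x) = f * x" "e * (f * x) = 0" "f * (e * x) = 0"
  by (simp_all add: mult.assoc[symmetric] idem)

lemma peirce_iff:
  "x \<in> peirce e e \<longleftrightarrow> e * x = x \<and> x * e = x"
  "x \<in> peirce e f \<longleftrightarrow> e * x = x \<and> x * f = x"
  "x \<in> peirce f e \<longleftrightarrow> f * x = x \<and> x * e = x"
  "x \<in> peirce f f \<longleftrightarrow> f * x = x \<and> x * f = x"
  unfolding peirce_def
  by (auto simp: mult.assoc idem idem_assoc) (metis mult.assoc)+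

lemma peirce_zeros:
  "x \<in> peirce e r \<Longrightarrow> f * x = 0" "x \<in> peirce f r \<Longrightarrow> e * x = 0"
  "x \<in> peirce r e \<Longrightarrow> x * f = 0" "x \<in> peirce r f \<Longrightarrow> x * e = 0"
  by (auto simp: peirce_def mult.assoc idem idem_assoc)

lemma orthogonal_mult:
  "x \<in> peirce r e \<Longrightarrow> y \<in> peirce f s \<Longrightarrow> x * y = 0"
  "x \<in> peirce r f \<Longrightarrow> y \<in> peirce e s \<Longrightarrow> x * y = 0"
  by (auto simp: peirce_def mult.assoc idem idem_assoc)

lemma in_peirce: "p * x * q \<in> peirce p q"
  by (auto simp: peirce_def)

lemma decompose: "x = e * x * e + e * x * f + f * x * e + f * x * f"
proof -
  have "x = (e + f) * x * (e + f)" by (simp add: sum_one)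
  then show ?thesis by (simp add: algebra_simps)
qed

lemma peirce_subset_diag: "peirce e e \<subseteq> peirce_diag e f" "peirce f f \<subseteq> peirce_diag e f"
  by (auto simp: peirce_def peirce_diag_def mult.assoc idem idem_assoc)

lemma diag_iff_commute: "x \<in> peirce_diag e f \<longleftrightarrow> e * x = x * e"
proof
  assume "x \<in> peirce_diag e f"
  then have "x = e * x * e + f * x * f" using decompose[of x] by (simp add: peirce_diag_def)
  then show "e * x = x * e"
    by (metis idem idem_assoc distrib_left distrib_right mult.assoc mult_zero_right add_0_right)
next
  assume *: "e * x = x * e"
  have "f * x * e = f * (x * e)" by (simp add: mult.assoc)
  also have "\<dots> = 0" by (simp add: *[symmetric] idem_assoc)
  finally have "f * x * e = 0" .
  moreover have "e * x * f = 0" by (simp add: * mult.assoc idem)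
  ultimately show "x \<in> peirce_diag e f" by (simp add: peirce_diag_def)
qed

lemma diag_mult_peirce:
  assumes "x \<in> peirce_diag e f"
  shows "y \<in> peirce e r \<Longrightarrow> x * y \<in> peirce e r" "y \<in> peirce r e \<Longrightarrow> y * x \<in> peirce r e"
proof -
  have c: "e * x = x * e" using assms by (simp add: diag_iff_commute)
  show "y \<in> peirce e r \<Longrightarrow> x * y \<in> peirce e r"
    unfolding peirce_def by (auto, metis c mult.assoc)
  show "y \<in> peirce r e \<Longrightarrow> y * x \<in> peirce r e"
    unfolding peirce_def by (auto, metis c mult.assoc)
qed

lemma diag_peirce_e:
  assumes "x \<in> peirce_diag e f" "f * x * f = 0" shows "x \<in> peirce e e"
proof -
  have "x = e * x * e" using assms decompose[of x] by (simp add: peirce_diag_def)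
  then show ?thesis using in_peirce[of e x e] by simp
qed

lemma diag_closed:
  assumes "x \<in> peirce_diag e f" "y \<in> peirce_diag e f"
  shows "x + y \<in> peirce_diag e f" "x - y \<in> peirce_diag e f"
    "commutator x y \<in> peirce_diag e f"
proof -
  have c: "e * x = x * e" "e * y = y * e" using assms by (simp_all add: diag_iff_commute)
  have xy: "e * (x * y) = x * y * e" "e * (y * x) = y * x * e"
    by (metis c mult.assoc)+
  show "x + y \<in> peirce_diag e f" "x - y \<in> peirce_diag e f"
    "commutator x y \<in> peirce_diag e f"
    using c xy by (simp_all add: diag_iff_commute commutator_def algebra_simps)
qed

lemma central_diag: "z \<in> centre UNIV \<Longrightarrow> z \<in> peirce_diag e f"
  by (simp add: diag_iff_commute centre_UNIV_iff)

text \<open>For \<open>y \<in> e\<A>e\<close> the commutator \<open>x y - y x\<close> lies in \<open>e\<A>e\<close> and annihilates \<open>M\<close> and \<open>T\<close>, because \<open>x\<close>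
  commutes with \<open>m\<close>, \<open>y m\<close>, \<open>t\<close> and \<open>t y\<close>. Faithfulness makes it zero.\<close>

lemma commutes_with_corner:
  assumes x: "x \<in> peirce_diag e f"
    and m: "\<And>m. m \<in> peirce e f \<Longrightarrow> x * m = m * x"
    and t: "\<And>t. t \<in> peirce f e \<Longrightarrow> x * t = t * x"
    and y: "y \<in> peirce e e"
  shows "x * y = y * x"
proof -
  have "x * y - y * x \<in> peirce e e"
    using diag_mult_peirce[OF x] y by (auto intro: peirce_diff)
  moreover have "(x * y - y * x) * m' = 0" if m': "m' \<in> peirce e f" for m'
    using m[OF m'] m[OF peirce_mult[OF y m']] by (simp add: algebra_simps)
  moreover have "t' * (x * y - y * x) = 0" if t': "t' \<in> peirce f e" for t'
    using t[OF t'] t[OF peirce_mult[OF t' y]]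
    by (simp add: algebra_simps) (metis mult.assoc)
  ultimately show ?thesis using faithful_e by (metis eq_iff_diff_eq_0)
qed

text \<open>Commuting with off-diagonal elements suffices for being central, because by faithfulness these detect
  the commutators with the corners.\<close>

lemma diag_central:
  assumes x: "x \<in> peirce_diag e f"
    and m: "\<And>m. m \<in> peirce e f \<Longrightarrow> commutator x m = 0"
    and t: "\<And>t. t \<in> peirce f e \<Longrightarrow> commutator x t = 0"
  shows "x \<in> centre UNIV"
proof -
  have m': "x * m = m * x" if "m \<in> peirce e f" for m
    using m[OF that] by (simp add: commutator_def)
  have t': "x * t = t * x" if "t \<in> peirce f e" for t
    using t[OF that] by (simp add: commutator_def)
  have ee: "x * y = y * x" if "y \<in> peirce e e" for y
    using commutes_with_corner[OF x m' t' that] .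
  have ff: "x * y = y * x" if "y \<in> peirce f f" for y
    using faithful_peirce.commutes_with_corner[OF swap _ t' m' that] x
    by (simp add: peirce_diag_commute)
  have "x * y = y * x" for y
  proof -
    have "x * (e * y * e) = e * y * e * x" "x * (e * y * f) = e * y * f * x"
      "x * (f * y * e) = f * y * e * x" "x * (f * y * f) = f * y * f * x"
      by (rule ee m' t' ff, rule in_peirce)+
    then show ?thesis
      by (subst (1 2) decompose[of y]) (simp only: distrib_left distrib_right)
  qed
  then show ?thesis by (simp add: centre_UNIV_iff)
qed

text \<open>A central \<open>z \<in> e\<A>e\<close> satisfies \<open>z m = m z = 0\<close> and \<open>t z = z t = 0\<close>. Consequently a central element is
  determined by either of its two corner components.\<close>

lemma central_corner_zero:
  assumes z: "z \<in> centre UNIV" "z \<in> peirce e e"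
  shows "z = 0"
proof -
  have "z * m = 0" if "m \<in> peirce e f" for m
    using orthogonal_mult(2)[OF that z(2)] by (simp add: centre_commute[OF z(1)])
  moreover have "t * z = 0" if "t \<in> peirce f e" for t
    using orthogonal_mult(1)[OF z(2) that] by (simp add: centre_commute[OF z(1)])
  ultimately show ?thesis using faithful_e[OF z(2)] by blast
qed

lemma central_corner:
  assumes z: "z \<in> centre UNIV"
  shows "e * z * e \<in> centre (peirce e e)"
proof -
  have "e * z * e * a = a * (e * z * e)" if "a \<in> peirce e e" for a
  proof -
    have a: "e * a = a" "a * e = a" using that by (simp_all add: peirce_iff)
    have "e * z * e * a = e * (z * a)" by (simp add: a mult.assoc)
    also have "\<dots> = a * z" by (simp add: centre_commute[OF z] a mult.assoc[symmetric])
    also have "\<dots> = a * e * (z * e)" by (simp add: a centre_commute[OF z] mult.assoc[symmetric])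
    finally show ?thesis by (simp add: mult.assoc)
  qed
  then show ?thesis by (simp add: centre_def in_peirce)
qed

end


section \<open>Maps that are Lie derivations up to the centre\<close>

text \<open>The element \<open>a\<close> is meant to lie in the corner of the idempotent \<open>p\<close>; then \<open>z\<close> is the value at \<open>a\<close> of
  the central-valued summand that is to be split off from \<open>\<delta>\<close>.\<close>

definition splits :: "('a::ring \<Rightarrow> 'a) \<Rightarrow> 'a \<Rightarrow> 'a \<Rightarrow> bool" where
  "splits \<delta> p a \<longleftrightarrow> (\<exists>z\<in>centre UNIV. \<delta> a - z \<in> peirce p p)"

text \<open>What remains of a normalized Lie \<open>n\<close>-derivation when the dependence on \<open>n\<close> is removed: the Lie
  derivation identity is required for a diagonal and an off-diagonal factor and for one factor from
  each off-diagonal block.\<close>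

locale peirce_lie_map = unital_algebra scale + faithful_peirce e f
  for scale :: "'r::comm_ring_1 \<Rightarrow> 'a::ring_1 \<Rightarrow> 'a" and e f :: 'a +
  fixes \<delta> :: "'a \<Rightarrow> 'a"
  assumes linear: "module_hom scale scale \<delta>"
    and diag: "x \<in> peirce_diag e f \<Longrightarrow> \<delta> x \<in> peirce_diag e f"
    and peirce_ef: "m \<in> peirce e f \<Longrightarrow> \<delta> m \<in> peirce e f"
    and peirce_fe: "t \<in> peirce f e \<Longrightarrow> \<delta> t \<in> peirce f e"
    and lie_ef: "x \<in> peirce_diag e f \<Longrightarrow> m \<in> peirce e f \<Longrightarrow>
          \<delta> (commutator x m) = commutator (\<delta> x) m + commutator x (\<delta> m)"
    and lie_fe: "x \<in> peirce_diag e f \<Longrightarrow> t \<in> peirce f e \<Longrightarrow>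
          \<delta> (commutator x t) = commutator (\<delta> x) t + commutator x (\<delta> t)"
    and lie_ef_fe: "m \<in> peirce e f \<Longrightarrow> t \<in> peirce f e \<Longrightarrow>
          \<delta> (commutator m t) = commutator (\<delta> m) t + commutator m (\<delta> t)"
begin

lemma swap_map: "peirce_lie_map scale f e \<delta>"
proof -
  interpret sw: faithful_peirce f e by (rule swap)
  show ?thesis
  proof
    show "\<delta> (commutator m t) = commutator (\<delta> m) t + commutator m (\<delta> t)"
      if "m \<in> peirce f e" "t \<in> peirce e f" for m t
    proof -
      have "\<delta> (- commutator t m) = - \<delta> (commutator t m)"
        by (rule module_hom.neg[OF linear])
      moreover have "commutator m t = - commutator t m" "commutator (\<delta> m) t = - commutator t (\<delta> m)"
        "commutator m (\<delta> t) = - commutator (\<delta> t) m"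
        by (simp_all add: commutator_def)
      ultimately show ?thesis by (simp add: lie_ef_fe that)
    qed
  qed (use linear module_hom.add[OF linear] module_hom.scale[OF linear] diag peirce_ef peirce_fe lie_ef lie_fe in
        \<open>auto simp: peirce_diag_commute[of f e]\<close>)
qed

lemmas \<delta>_simps = module_hom.add[OF linear] module_hom.neg[OF linear] module_hom.diff[OF linear]
  module_hom.zero[OF linear]

lemma diag_commutator_peirce:
  assumes "x \<in> peirce_diag e f"
  shows "m \<in> peirce e f \<Longrightarrow> commutator x m \<in> peirce e f"
    "t \<in> peirce f e \<Longrightarrow> commutator x t \<in> peirce f e"
  using assms diag_mult_peirce faithful_peirce.diag_mult_peirce[OF swap]
  by (auto simp: commutator_def peirce_diag_commute intro!: peirce_diff)

text \<open>Compute \<open>\<delta> [[x, y], w]\<close> for off-diagonal \<open>w\<close> directly and by the Jacobi identity: the difference of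
  the two results is the commutator of \<open>w\<close> with the element in question, which is therefore central
  by \<open>diag_central\<close>.\<close>

lemma lie_diag_mod_centre:
  assumes x: "x \<in> peirce_diag e f" and y: "y \<in> peirce_diag e f"
  shows "\<delta> (commutator x y) - (commutator (\<delta> x) y + commutator x (\<delta> y)) \<in> centre UNIV"
proof (rule diag_central)
  note xy = diag_closed(3)[OF x y]
  show "\<delta> (commutator x y) - (commutator (\<delta> x) y + commutator x (\<delta> y)) \<in> peirce_diag e f"
    using diag x y xy by (intro diag_closed) auto
  have *: "commutator (\<delta> (commutator x y) - (commutator (\<delta> x) y + commutator x (\<delta> y))) w = 0"
    if "\<delta> (commutator (commutator x y) w) =
          commutator (\<delta> (commutator x y)) w + commutator (commutator x y) (\<delta> w)"
      "\<delta> (commutator x (commutator y w)) =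
          commutator (\<delta> x) (commutator y w) + commutator x (\<delta> (commutator y w))"
      "\<delta> (commutator y (commutator x w)) =
          commutator (\<delta> y) (commutator x w) + commutator y (\<delta> (commutator x w))"
      "\<delta> (commutator y w) = commutator (\<delta> y) w + commutator y (\<delta> w)"
      "\<delta> (commutator x w) = commutator (\<delta> x) w + commutator x (\<delta> w)" for w
  proof -
    have "commutator (\<delta> (commutator x y)) w =
        \<delta> (commutator x (commutator y w)) - \<delta> (commutator y (commutator x w))
        - commutator (commutator x y) (\<delta> w)"
      using that(1) unfolding commutator_jacobi \<delta>_simps by simp
    then show ?thesis unfolding that(2-5)
      by (simp add: commutator_simps commutator_jacobi)
  qed
  show "commutator (\<delta> (commutator x y) - (commutator (\<delta> x) y + commutator x (\<delta> y))) w = 0"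
    if w: "w \<in> peirce e f" for w
    by (intro * lie_ef x y xy w diag_commutator_peirce)
  show "commutator (\<delta> (commutator x y) - (commutator (\<delta> x) y + commutator x (\<delta> y))) w = 0"
    if w: "w \<in> peirce f e" for w
    by (intro * lie_fe x y xy w diag_commutator_peirce)
qed

lemma ee_diag: "a \<in> peirce e e \<Longrightarrow> a \<in> peirce_diag e f"
  using peirce_subset_diag by blast

lemma ff_diag: "a \<in> peirce f f \<Longrightarrow> a \<in> peirce_diag e f"
  using peirce_subset_diag by blast

lemma ee_commutator:
  assumes "a \<in> peirce e e"
  shows "m \<in> peirce e f \<Longrightarrow> commutator a m = a * m"
    "t \<in> peirce f e \<Longrightarrow> commutator a t = - (t * a)"
  using assms orthogonal_mult by (auto simp: commutator_def)

lemma splitsI_corner: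
  assumes a: "a \<in> peirce e e" and z: "z \<in> centre UNIV" and eq: "f * \<delta> a * f = f * z * f"
  shows "splits \<delta> e a"
  unfolding splits_def
proof (rule bexI[OF _ z], rule diag_peirce_e)
  show "\<delta> a - z \<in> peirce_diag e f"
    by (intro diag_closed diag ee_diag a central_diag z)
  show "f * (\<delta> a - z) * f = 0" using eq by (simp add: algebra_simps)
qed

lemma splits_commutator:
  assumes a: "a \<in> peirce e e" and b: "b \<in> peirce e e"
  shows "splits \<delta> e (commutator a b)"
  unfolding splits_def
proof (rule bexI[OF _ lie_diag_mod_centre[OF ee_diag[OF a] ee_diag[OF b]]])
  have "commutator x y \<in> peirce e e" "commutator y x \<in> peirce e e"
    if "x \<in> peirce e e" "y \<in> peirce_diag e f" for x y
    using that diag_mult_peirce by (auto simp: commutator_def intro!: peirce_diff)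
  then show "\<delta> (commutator a b) -
      (\<delta> (commutator a b) - (commutator (\<delta> a) b + commutator a (\<delta> b))) \<in> peirce e e"
    using a b diag ee_diag by (auto intro!: peirce_add)
qed

text \<open>If \<open>\<delta> a\<close> and \<open>\<delta> b\<close> are \<open>h\<close> and \<open>k\<close> modulo the centre, then \<open>\<delta> (a m) = h m + a (\<delta> m)\<close> and
  \<open>\<delta> (b m) = k m + b (\<delta> m)\<close>. Evaluating \<open>\<delta> (a b m)\<close> with these shows that \<open>h b + a k\<close>, which the product
  rule predicts for \<open>\<delta> (a b)\<close>, has the same commutators with \<open>M\<close> and \<open>T\<close> as \<open>\<delta> (a b)\<close>.\<close>

lemma splits_mult:
  assumes a: "a \<in> peirce e e" "splits \<delta> e a" and b: "b \<in> peirce e e" "splits \<delta> e b"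
  shows "splits \<delta> e (a * b)"
proof -
  obtain z where z: "z \<in> centre UNIV" "\<delta> a - z \<in> peirce e e" using a splits_def by blast
  obtain w where w: "w \<in> centre UNIV" "\<delta> b - w \<in> peirce e e" using b splits_def by blast
  define h k where "h = \<delta> a - z" and "k = \<delta> b - w"
  have h: "h \<in> peirce e e" "\<And>x. commutator (\<delta> a) x = commutator h x"
    and k: "k \<in> peirce e e" "\<And>x. commutator (\<delta> b) x = commutator k x"
    using z w by (simp_all add: h_def k_def commutator_simps centre_commutator)
  have ab: "a * b \<in> peirce e e" using peirce_mult[OF a(1) b(1)] .
  have hk: "h * b + a * k \<in> peirce e e"
    by (intro peirce_add peirce_mult[OF h(1) b(1)] peirce_mult[OF a(1) k(1)])
  have "\<delta> (a * b) - (h * b + a * k) \<in> centre UNIV"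
  proof (rule diag_central)
    show "\<delta> (a * b) - (h * b + a * k) \<in> peirce_diag e f"
      by (intro diag_closed(2) diag ee_diag ab hk)
  next
    fix m assume m: "m \<in> peirce e f"
    note bm = peirce_mult[OF b(1) m]
    have 1: "\<delta> (a * (b * m)) = h * (b * m) + a * \<delta> (b * m)"
      using lie_ef[OF ee_diag[OF a(1)] bm]
      by (simp add: h ee_commutator[OF a(1)] ee_commutator[OF h(1)] bm peirce_ef)
    have 2: "\<delta> (b * m) = k * m + b * \<delta> m"
      using lie_ef[OF ee_diag[OF b(1)] m]
      by (simp add: k ee_commutator[OF b(1)] ee_commutator[OF k(1)] m peirce_ef)
    have 3: "\<delta> (a * b * m) = commutator (\<delta> (a * b)) m + a * b * \<delta> m"
      using lie_ef[OF ee_diag[OF ab] m] by (simp add: ee_commutator[OF ab] m peirce_ef)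
    show "commutator (\<delta> (a * b) - (h * b + a * k)) m = 0"
      using 1 2 3 ee_commutator(1)[OF hk m] by (simp add: commutator_simps(3) algebra_simps)
  next
    fix t assume t: "t \<in> peirce f e"
    note ta = peirce_mult[OF t a(1)]
    have 1: "\<delta> (t * a * b) = t * a * k + \<delta> (t * a) * b"
      using lie_fe[OF ee_diag[OF b(1)] ta]
      by (simp add: k ee_commutator[OF b(1)] ee_commutator[OF k(1)] ta peirce_fe \<delta>_simps
          neg_eq_iff)
    have 2: "\<delta> (t * a) = t * h + \<delta> t * a"
      using lie_fe[OF ee_diag[OF a(1)] t]
      by (simp add: h ee_commutator[OF a(1)] ee_commutator[OF h(1)] t peirce_fe \<delta>_simps
          neg_eq_iff)
    have 3: "- \<delta> (t * (a * b)) = commutator (\<delta> (a * b)) t - \<delta> t * (a * b)"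
      using lie_fe[OF ee_diag[OF ab] t] by (simp add: ee_commutator[OF ab] t peirce_fe \<delta>_simps)
    show "commutator (\<delta> (a * b) - (h * b + a * k)) t = 0"
      using 1 2 3 ee_commutator(2)[OF hk t] by (simp add: commutator_simps(3) algebra_simps)
  qed
  then show ?thesis unfolding splits_def by (rule bexI[rotated]) (use hk in \<open>simp add: add.commute\<close>)
qed

text \<open>A derivation \<open>d\<close> satisfies \<open>d p = [[d p, p], p]\<close> at an idempotent \<open>p\<close>. This suggests
  \<open>h = [[\<delta> p, p], p]\<close> as the part of \<open>\<delta> p\<close> in the corner. That the rest is central follows from
  \<open>p (p m) = p m\<close> and \<open>(t p) p = t p\<close>.\<close>

lemma splits_idempotent:
  assumes p: "p \<in> peirce e e" "p * p = p"
  shows "splits \<delta> e p"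
proof -
  define x where "x = \<delta> p"
  define h where "h = x * p + p * x - 2 * (p * x * p)"
  have pp: "p * (p * y) = p * y" for y by (simp add: mult.assoc[symmetric] p)
  have x: "x \<in> peirce_diag e f" unfolding x_def by (intro diag ee_diag p)
  have h: "h \<in> peirce e e"
    unfolding h_def mult_2 using p(1) diag_mult_peirce[OF x] peirce_mult
    by (intro peirce_diff peirce_add) blast+
  have "x - h \<in> centre UNIV"
  proof (rule diag_central)
    show "x - h \<in> peirce_diag e f" by (intro diag_closed(2) x ee_diag h)
  next
    fix m assume m: "m \<in> peirce e f"
    note pm = peirce_mult[OF p(1) m]
    \<comment> \<open>Two evaluations of \<open>\<delta> (p m) = \<delta> (p (p m))\<close>, compared after multiplication by \<open>p\<close>.\<close>
    have "\<delta> (p * m) = commutator x m + p * \<delta> m"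
      using lie_ef[OF ee_diag[OF p(1)] m] by (simp add: x_def ee_commutator[OF p(1)] m peirce_ef)
    moreover have "\<delta> (p * m) = commutator x (p * m) + p * \<delta> (p * m)"
      using lie_ef[OF ee_diag[OF p(1)] pm]
      by (simp add: x_def ee_commutator[OF p(1)] pm peirce_ef pp)
    ultimately have *: "commutator x m = commutator x (p * m) + p * commutator x m"
      by (simp add: distrib_left pp)
    then have "p * commutator x m = p * commutator x (p * m) + p * commutator x m"
      by (metis distrib_left pp)
    then have pmx: "p * (m * x) = p * (x * (p * m))"
      by (simp add: commutator_def right_diff_distrib mult.assoc pp)
    have "m * h = 0" by (rule orthogonal_mult(2)[OF m h])
    with * pmx show "commutator (x - h) m = 0"
      by (simp add: commutator_def h_def algebra_simps mult_2)
  next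
    fix t assume t: "t \<in> peirce f e"
    note tp = peirce_mult[OF t p(1)]
    have "\<delta> (t * p) = \<delta> t * p - commutator x t"
      using lie_fe[OF ee_diag[OF p(1)] t]
      by (simp add: x_def ee_commutator[OF p(1)] t peirce_fe \<delta>_simps algebra_simps neg_eq_diff_iff)
    moreover have "\<delta> (t * p) = \<delta> (t * p) * p - commutator x (t * p)"
      using lie_fe[OF ee_diag[OF p(1)] tp]
      by (simp add: x_def ee_commutator[OF p(1)] tp peirce_fe \<delta>_simps mult.assoc p neg_eq_diff_iff)
    ultimately have "\<delta> t * p - commutator x t = (\<delta> t * p - commutator x t) * p - commutator x (t * p)"
      by simp
    then have *: "commutator x t = commutator x (t * p) + commutator x t * p"
      by (simp add: left_diff_distrib mult.assoc p(2) diff_eq_eq eq_diff_eq ac_simps(1-3))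
        (simp add: add_diff_eq)
    then have "commutator x t * p = commutator x (t * p) * p + commutator x t * p"
      by (metis distrib_right mult.assoc p(2))
    then have xtp: "x * (t * p) = t * (p * (x * p))"
      by (simp add: commutator_def left_diff_distrib mult.assoc p)
    have "h * t = 0" by (rule orthogonal_mult(1)[OF h t])
    with * xtp show "commutator (x - h) t = 0"
      by (simp add: commutator_def h_def algebra_simps mult_2)
  qed
  then show ?thesis unfolding splits_def x_def[symmetric] by (rule bexI[rotated]) (simp add: h)
qed


text \<open>Apply \<open>lie_diag_mod_centre\<close> to \<open>[a, b] = 0\<close>.\<close>

lemma cross_commutator:
  assumes a: "a \<in> peirce e e" and b: "b \<in> peirce f f"
  shows "commutator (\<delta> a) b + commutator a (\<delta> b) \<in> centre UNIV"
proof -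
  have "commutator a b = 0"
    by (simp add: commutator_def orthogonal_mult(1)[OF a b] orthogonal_mult(2)[OF b a])
  then show ?thesis
    using centre_uminus[OF lie_diag_mod_centre[OF ee_diag[OF a] ff_diag[OF b]]]
    by (simp add: \<delta>_simps add.commute)
qed

lemma diag_commutator_ee:
  "x \<in> peirce_diag e f \<Longrightarrow> a \<in> peirce e e \<Longrightarrow> commutator x a \<in> peirce e e"
  "x \<in> peirce_diag e f \<Longrightarrow> a \<in> peirce e e \<Longrightarrow> commutator a x \<in> peirce e e"
  using diag_mult_peirce by (auto simp: commutator_def intro!: peirce_diff)

lemma corner_in_centre_iff:
  assumes x: "x \<in> peirce_diag e f"
  shows "e * x * e \<in> centre (peirce e e) \<longleftrightarrow> (\<forall>a\<in>peirce e e. commutator x a = 0)"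
proof -
  have "e * x * e * a = x * a" "a * (e * x * e) = a * x" if "a \<in> peirce e e" for a
  proof -
    have a: "e * a = a" "a * e = a" using that by (simp_all add: peirce_iff)
    have c: "e * x = x * e" using x by (simp add: diag_iff_commute)
    show "e * x * e * a = x * a" by (simp add: c mult.assoc a)
    have "e * x * e = e * x" by (simp add: mult.assoc c[symmetric] idem_assoc)
    then show "a * (e * x * e) = a * x" by (simp add: mult.assoc[symmetric] a)
  qed
  then show ?thesis
    by (auto simp: centre_def in_peirce commutator_def)
qed

text \<open>If \<open>a\<close> splits, then \<open>\<delta> a\<close> commutes with \<open>b\<close>, so that \<open>[a, \<delta> b]\<close> is a central element of the corner
  \<open>e\<A>e\<close> and vanishes.\<close>

lemma centre_corner_of_splits:
  assumes all: "\<And>a. a \<in> peirce e e \<Longrightarrow> splits \<delta> e a" and b: "b \<in> peirce f f"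
  shows "e * \<delta> b * e \<in> centre (peirce e e)"
proof -
  have \<delta>b: "\<delta> b \<in> peirce_diag e f" by (intro diag ff_diag b)
  have "commutator (\<delta> b) a = 0" if a: "a \<in> peirce e e" for a
  proof -
    obtain z where z: "z \<in> centre UNIV" "\<delta> a - z \<in> peirce e e"
      using all[OF a] splits_def by blast
    have "commutator (\<delta> a - z) b = 0"
      using orthogonal_mult(1)[OF z(2) b] orthogonal_mult(2)[OF b z(2)] by (simp add: commutator_def)
    then have "commutator (\<delta> a) b = 0"
      by (simp add: commutator_simps centre_commutator[OF z(1)])
    then have "commutator a (\<delta> b) \<in> centre UNIV" using cross_commutator[OF a b] by simp
    then have "commutator a (\<delta> b) = 0"
      using central_corner_zero diag_commutator_ee(2)[OF \<delta>b a] by blast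
    then show ?thesis by (simp add: commutator_def)
  qed
  then show ?thesis by (simp add: corner_in_centre_iff[OF \<delta>b])
qed

lemma splits_of_centre_corner:
  assumes "centre (peirce f f) = (\<lambda>z. f * z * f) ` centre UNIV"
    and a: "a \<in> peirce e e" and "f * \<delta> a * f \<in> centre (peirce f f)"
  shows "splits \<delta> e a"
  using assms splitsI_corner[OF a] by auto

text \<open>The component of \<open>cross_commutator\<close> in \<open>f\<A>f\<close> is \<open>[f \<delta>(a) f, b]\<close>, and components of central elements are
  central in the corner; so property (P) applies to \<open>f \<delta>(a) f\<close>.\<close>

lemma centre_corner_of_property_P:
  assumes P: "property_P (peirce f f)" and a: "a \<in> peirce e e"
  shows "f * \<delta> a * f \<in> centre (peirce f f)"
proof -
  interpret sw: peirce_lie_map scale f e \<delta> by (rule swap_map)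
  have \<delta>a: "\<delta> a \<in> peirce_diag f e" by (intro sw.diag sw.ff_diag a)
  have "commutator (f * \<delta> a * f) b \<in> centre (peirce f f)" if b: "b \<in> peirce f f" for b
  proof -
    define z where "z = commutator (\<delta> a) b + commutator a (\<delta> b)"
    have z: "z \<in> centre UNIV" unfolding z_def by (rule cross_commutator[OF a b])
    have b': "f * b = b" "b * f = b" using b by (simp_all add: peirce_iff)
    have b'': "f * (b * y) = b * y" "b * (f * y) = b * y" for y
      by (simp_all add: mult.assoc[symmetric] b')
    have "f * commutator a (\<delta> b) = 0"
      using diag_commutator_ee(2)[OF _ a] diag b ff_diag peirce_zeros(1) by blast
    moreover have "f * commutator (\<delta> a) b * f = commutator (f * \<delta> a * f) b"
      by (simp add: commutator_def left_diff_distrib right_diff_distrib mult.assoc b' b'')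
    ultimately have "f * z * f = commutator (f * \<delta> a * f) b"
      by (simp add: z_def distrib_left distrib_right)
    then show ?thesis using sw.central_corner[OF z] by simp
  qed
  then show ?thesis using P in_peirce unfolding property_P_def by blast
qed

lemma splits_of_alg_S:
  assumes S: "peirce e e = alg_S scale (peirce e e)" and a: "a \<in> peirce e e"
  shows "splits \<delta> e a"
proof -
  let ?U = "{a \<in> peirce e e. splits \<delta> e a}"
  have "splits \<delta> e (x + y)" if xy: "splits \<delta> e x" "splits \<delta> e y" for x y
  proof -
    obtain z w where "z \<in> centre UNIV" "\<delta> x - z \<in> peirce e e" "w \<in> centre UNIV" "\<delta> y - w \<in> peirce e e"
      using xy splits_def by blast
    moreover from this have "\<delta> (x + y) - (z + w) \<in> peirce e e"
      using peirce_add[of "\<delta> x - z" e e "\<delta> y - w"] by (simp add: \<delta>_simps algebra_simps)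
    ultimately show ?thesis unfolding splits_def using centre_add by blast
  qed
  moreover have "splits \<delta> e (scale r x)" if x: "splits \<delta> e x" for r x
  proof -
    obtain z where "z \<in> centre UNIV" "\<delta> x - z \<in> peirce e e"
      using x splits_def by blast
    moreover from this have "\<delta> (scale r x) - scale r z \<in> peirce e e"
      using scale_peirce[of "\<delta> x - z" e e r]
      by (simp add: module_hom.scale[OF linear] scale_right_diff_distrib)
    ultimately show ?thesis unfolding splits_def using scale_centre by blast
  qed
  moreover have "splits \<delta> e 0"
    unfolding splits_def using centre_zero by (auto intro!: bexI[of _ 0] simp: \<delta>_simps peirce_zero)
  ultimately have "subalgebra scale ?U"
    unfolding subalgebra_def subspace_def
    by (auto intro: peirce_add peirce_mult splits_mult scale_peirce peirce_zero)
  then have "alg_S scale (peirce e e) \<subseteq> ?U"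
    unfolding alg_S_def
    by (intro hull_minimal)
      (auto intro: splits_idempotent splits_commutator diag_commutator_ee ee_diag)
  then show ?thesis using S a by blast
qed

text \<open>The hypotheses are the four alternatives of the first group, with a weaker last one: property (P)
  is only a means to get \<open>f \<delta>(a) f \<in> \<Z>(f\<A>f)\<close>, which for \<open>n = 2\<close> holds for another reason.\<close>

lemma corners_split:
  assumes cases: "(peirce e e = alg_S scale (peirce e e) \<and> peirce f f = alg_S scale (peirce f f))
          \<or> (peirce e e = alg_S scale (peirce e e) \<and>
             centre (peirce e e) = (\<lambda>z. e * z * e) ` centre UNIV)
          \<or> (peirce f f = alg_S scale (peirce f f) \<and>
             centre (peirce f f) = (\<lambda>z. f * z * f) ` centre UNIV)
          \<or> (centre (peirce e e) = (\<lambda>z. e * z * e) ` centre UNIV \<and>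
             centre (peirce f f) = (\<lambda>z. f * z * f) ` centre UNIV \<and>
             ((\<forall>a\<in>peirce e e. f * \<delta> a * f \<in> centre (peirce f f)) \<or>
              property_P (peirce e e) \<or> property_P (peirce f f)))"
  shows "(\<forall>a\<in>peirce e e. splits \<delta> e a) \<and> (\<forall>b\<in>peirce f f. splits \<delta> f b)"
proof -
  interpret sw: peirce_lie_map scale f e \<delta> by (rule swap_map)
  have e_f: "\<forall>b\<in>peirce f f. splits \<delta> f b"
    if "\<forall>a\<in>peirce e e. splits \<delta> e a" "centre (peirce e e) = (\<lambda>z. e * z * e) ` centre UNIV"
    using that centre_corner_of_splits sw.splits_of_centre_corner by blast
  have f_e: "\<forall>a\<in>peirce e e. splits \<delta> e a"
    if "\<forall>b\<in>peirce f f. splits \<delta> f b" "centre (peirce f f) = (\<lambda>z. f * z * f) ` centre UNIV"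
    using that sw.centre_corner_of_splits splits_of_centre_corner by blast
  from cases show ?thesis
  proof (elim disjE conjE)
    assume "peirce e e = alg_S scale (peirce e e)" "peirce f f = alg_S scale (peirce f f)"
    then show ?thesis using splits_of_alg_S sw.splits_of_alg_S by blast
  next
    assume "peirce e e = alg_S scale (peirce e e)" "centre (peirce e e) = (\<lambda>z. e * z * e) ` centre UNIV"
    then show ?thesis using splits_of_alg_S e_f by blast
  next
    assume "peirce f f = alg_S scale (peirce f f)" "centre (peirce f f) = (\<lambda>z. f * z * f) ` centre UNIV"
    then show ?thesis using sw.splits_of_alg_S f_e by blast
  next
    assume *: "centre (peirce e e) = (\<lambda>z. e * z * e) ` centre UNIV"
      "centre (peirce f f) = (\<lambda>z. f * z * f) ` centre UNIV"
    show ?thesis if "\<forall>a\<in>peirce e e. f * \<delta> a * f \<in> centre (peirce f f)"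
      using that * splits_of_centre_corner e_f by blast
    show ?thesis if "property_P (peirce f f)"
      using that * splits_of_centre_corner centre_corner_of_property_P e_f by blast
    show ?thesis if "property_P (peirce e e)"
      using that * sw.splits_of_centre_corner sw.centre_corner_of_property_P f_e by blast
  qed
qed

text \<open>The central element by which \<open>\<delta> (e x e)\<close> differs from the corner is unique, because the corner has no
  nonzero central elements of \<open>\<A>\<close>; uniqueness makes it depend linearly on \<open>x\<close>.\<close>

lemma central_part:
  assumes all: "\<And>a. a \<in> peirce e e \<Longrightarrow> splits \<delta> e a"
  obtains \<tau> where "module_hom scale scale \<tau>" "\<And>x. \<tau> x \<in> centre UNIV"
    "\<And>x. \<delta> (e * x * e) - \<tau> x \<in> peirce e e" "\<And>x. e * x * e = 0 \<Longrightarrow> \<tau> x = 0"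
proof -
  have "\<forall>x. \<exists>z. z \<in> centre UNIV \<and> \<delta> (e * x * e) - z \<in> peirce e e"
    using all[OF in_peirce] unfolding splits_def by blast
  then obtain \<tau> where \<tau>: "\<And>x. \<tau> x \<in> centre UNIV" "\<And>x. \<delta> (e * x * e) - \<tau> x \<in> peirce e e"
    by metis
  have unique: "\<tau> x = z" if "z \<in> centre UNIV" "\<delta> (e * x * e) - z \<in> peirce e e" for x z
    using central_corner_zero[OF centre_diff[OF \<tau>(1)[of x] that(1)]]
      peirce_diff[OF that(2) \<tau>(2)[of x]] by (simp add: algebra_simps)
  show thesis
  proof (rule that)
    show "module_hom scale scale \<tau>"
    proof unfold_locales
      show "\<tau> (x + y) = \<tau> x + \<tau> y" for x y
        using peirce_add[OF \<tau>(2)[of x] \<tau>(2)[of y]]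
        by (intro unique centre_add \<tau>) (simp add: algebra_simps \<delta>_simps)
      show "\<tau> (scale r x) = scale r (\<tau> x)" for r x
        using scale_peirce[OF \<tau>(2)[of x], of r]
        by (intro unique scale_centre \<tau>)
          (simp add: scale_mult_left scale_mult_right module_hom.scale[OF linear]
            scale_right_diff_distrib)
    qed
    show "\<tau> x = 0" if "e * x * e = 0" for x
      by (intro unique centre_zero) (simp add: that \<delta>_simps peirce_zero)
  qed (rule \<tau>)+
qed

end

section \<open>Derivations up to the products of the two off-diagonal blocks\<close>

definition defect :: "('a::ring \<Rightarrow> 'a) \<Rightarrow> 'a \<Rightarrow> 'a \<Rightarrow> 'a" where
  "defect h x y = h (x * y) - h x * y - x * h y"

text \<open>The defect is the Hochschild coboundary of \<open>h\<close> up to sign, and a coboundary is a cocycle.\<close>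

lemma defect_cocycle:
  "x * defect h y w - defect h (x * y) w + defect h x (y * w) - defect h x y * w = 0"
  by (simp add: defect_def algebra_simps)

text \<open>The map \<open>h = \<delta> - \<tau>\<close> obtained by splitting off the central part. On \<open>M \<times> T\<close> the identity for
  \<open>\<delta> [m, t]\<close> survives only modulo the centre, as \<open>\<tau> [m, t]\<close> is not yet known to vanish.\<close>

locale peirce_derivation = unital_algebra scale + faithful_peirce e f
  for scale :: "'r::comm_ring_1 \<Rightarrow> 'a::ring_1 \<Rightarrow> 'a" and e f :: 'a +
  fixes h :: "'a \<Rightarrow> 'a"
  assumes linear: "module_hom scale scale h"
    and h_ee: "a \<in> peirce e e \<Longrightarrow> h a \<in> peirce e e"
    and h_ef: "m \<in> peirce e f \<Longrightarrow> h m \<in> peirce e f"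
    and h_fe: "t \<in> peirce f e \<Longrightarrow> h t \<in> peirce f e"
    and h_ff: "b \<in> peirce f f \<Longrightarrow> h b \<in> peirce f f"
    and defect_ee_ef: "a \<in> peirce e e \<Longrightarrow> m \<in> peirce e f \<Longrightarrow> defect h a m = 0"
    and defect_ef_ff: "m \<in> peirce e f \<Longrightarrow> b \<in> peirce f f \<Longrightarrow> defect h m b = 0"
    and defect_ff_fe: "b \<in> peirce f f \<Longrightarrow> t \<in> peirce f e \<Longrightarrow> defect h b t = 0"
    and defect_fe_ee: "t \<in> peirce f e \<Longrightarrow> a \<in> peirce e e \<Longrightarrow> defect h t a = 0"
    and defect_mod_centre: "m \<in> peirce e f \<Longrightarrow> t \<in> peirce f e \<Longrightarrow>
          defect h m t - defect h t m \<in> centre UNIV"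
begin

lemma swap_derivation: "peirce_derivation scale f e h"
proof -
  interpret sw: faithful_peirce f e by (rule swap)
  show ?thesis
  proof
    show "defect h m t - defect h t m \<in> centre UNIV" if "m \<in> peirce f e" "t \<in> peirce e f" for m t
      using centre_uminus[OF defect_mod_centre[OF that(2,1)]] by simp
  qed (use linear module_hom.add[OF linear] module_hom.scale[OF linear] h_ee h_ef h_fe h_ff
      defect_ee_ef defect_ef_ff defect_ff_fe defect_fe_ee in auto)
qed

lemmas h_simps = module_hom.add[OF linear] module_hom.neg[OF linear] module_hom.diff[OF linear]
  module_hom.zero[OF linear]

lemma defect_add:
  "defect h (x + x') y = defect h x y + defect h x' y"
  "defect h x (y + y') = defect h x y + defect h x y'"
  by (simp_all add: defect_def h_simps algebra_simps)

lemma defect_ef_fe: "m \<in> peirce e f \<Longrightarrow> t \<in> peirce f e \<Longrightarrow> defect h m t \<in> peirce e e"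
  unfolding defect_def by (intro peirce_diff h_ee) (blast intro: peirce_mult h_ef h_fe)+

lemma defect_fe_ef: "t \<in> peirce f e \<Longrightarrow> m \<in> peirce e f \<Longrightarrow> defect h t m \<in> peirce f f"
  unfolding defect_def by (intro peirce_diff h_ff) (blast intro: peirce_mult h_ef h_fe)+

text \<open>By the cocycle identity \<open>defect h a b\<close> annihilates \<open>M\<close> and \<open>T\<close>, as the defect is zero as soon as one of
  the factors lies in the corner and the other one is off-diagonal.\<close>

lemma defect_ee_ee:
  assumes a: "a \<in> peirce e e" and b: "b \<in> peirce e e"
  shows "defect h a b = 0"
proof (rule faithful_e)
  show "defect h a b \<in> peirce e e"
    unfolding defect_def by (intro peirce_diff h_ee) (blast intro: peirce_mult h_ee a b)+
  show "defect h a b * m = 0" if m: "m \<in> peirce e f" for m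
    using defect_cocycle[of a h b m]
    by (simp add: defect_ee_ef a b m peirce_mult[OF a b] peirce_mult[OF b m])
  show "t * defect h a b = 0" if t: "t \<in> peirce f e" for t
    using defect_cocycle[of t h a b]
    by (simp add: defect_fe_ee a b t peirce_mult[OF a b] peirce_mult[OF t a])
qed

text \<open>This makes the values of the defect on \<open>M \<times> T\<close> close under multiplication by \<open>e\<A>e\<close>.\<close>

lemma defect_ideal:
  assumes a: "a \<in> peirce e e" and m: "m \<in> peirce e f" and t: "t \<in> peirce f e"
  shows "defect h (a * m) t = a * defect h m t"
  using defect_cocycle[of a h m t]
  by (simp add: defect_ee_ee a peirce_mult[OF m t] defect_ee_ef m)

lemma defect_assoc:
  assumes m: "m \<in> peirce e f" and t: "t \<in> peirce f e" and m': "m' \<in> peirce e f"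
  shows "defect h m t * m' = m * defect h t m'"
  using defect_cocycle[of m h t m']
  by (simp add: defect_ee_ef defect_ef_ff m m' peirce_mult[OF m t] peirce_mult[OF t m'])

lemma defect_central_part:
  assumes m: "m \<in> peirce e f" and t: "t \<in> peirce f e"
  shows "e * (defect h m t - defect h t m) * e = defect h m t"
  using defect_ef_fe[OF m t] peirce_zeros(2)[OF defect_fe_ef[OF t m]]
  by (simp add: right_diff_distrib left_diff_distrib peirce_iff)

lemma defect_centre:
  assumes m: "m \<in> peirce e f" and t: "t \<in> peirce f e"
  shows "defect h m t \<in> (\<lambda>z. e * z * e) ` centre UNIV" "defect h m t \<in> centre (peirce e e)"
  using imageI[OF defect_mod_centre[OF m t], of "\<lambda>z. e * z * e"]
    central_corner[OF defect_mod_centre[OF m t]]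
  by (simp_all add: defect_central_part m t)

text \<open>Move the central element \<open>defect h m t - defect h t m\<close> past \<open>m'\<close> and apply \<open>defect_assoc\<close>.\<close>

lemma defect_alternating:
  assumes m: "m \<in> peirce e f" and t: "t \<in> peirce f e" and m': "m' \<in> peirce e f"
  shows "defect h m t * m' = - (defect h m' t * m)"
proof -
  let ?z = "defect h m t - defect h t m"
  have "defect h m t * m' = ?z * m'"
    using orthogonal_mult(2)[OF defect_fe_ef[OF t m] m'] by (simp add: left_diff_distrib)
  also have "\<dots> = m' * ?z" by (rule centre_commute[OF defect_mod_centre[OF m t]])
  also have "\<dots> = - (m' * defect h t m)"
    using orthogonal_mult(2)[OF m' defect_ef_fe[OF m t]] by (simp add: right_diff_distrib)
  finally show ?thesis by (simp add: defect_assoc m t m')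
qed

lemma defect_fe_ef_zero:
  assumes "\<And>m t. m \<in> peirce e f \<Longrightarrow> t \<in> peirce f e \<Longrightarrow> defect h m t = 0"
    and m: "m \<in> peirce e f" and t: "t \<in> peirce f e"
  shows "defect h t m = 0"
  using defect_mod_centre[OF m t] assms centre_uminus[of "- defect h t m"]
    faithful_peirce.central_corner_zero[OF swap] defect_fe_ef[OF t m] by simp

text \<open>The defect on \<open>M \<times> T\<close> takes values in the largest central ideal of \<open>e\<A>e\<close>, which consists of the central
  \<open>c\<close> for which \<open>x c\<close> is central for every \<open>x\<close>.\<close>

lemma defect_zero_of_no_central_ideal:
  assumes no_ideal: "\<forall>I. central_ideal scale (peirce e e) I \<longrightarrow> I = {0}"
    and m: "m \<in> peirce e f" and t: "t \<in> peirce f e"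
  shows "defect h m t = 0"
proof -
  define C where "C = centre (peirce e e)"
  define I where "I = {c \<in> C. \<forall>x\<in>peirce e e. x * c \<in> C}"
  have C_sub: "C \<subseteq> peirce e e" by (auto simp: C_def centre_def)
  have C_comm: "c * x = x * c" if "c \<in> C" "x \<in> peirce e e" for c x
    using that by (auto simp: C_def centre_def)
  have C0: "0 \<in> C" and C_add: "\<And>x y. x \<in> C \<Longrightarrow> y \<in> C \<Longrightarrow> x + y \<in> C"
    and C_scale: "\<And>r x. x \<in> C \<Longrightarrow> scale r x \<in> C"
    by (auto simp: C_def centre_def peirce_zero peirce_add scale_peirce distrib_left distrib_right
        scale_mult_left scale_mult_right)
  have "central_ideal scale (peirce e e) I"
    unfolding central_ideal_def subspace_def
  proof (intro conjI ballI allI)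
    show "I \<subseteq> centre (peirce e e)" by (auto simp: I_def C_def)
    fix c b assume c: "c \<in> I" and b: "b \<in> peirce e e"
    show bc: "b * c \<in> I"
      using c b by (auto simp: I_def mult.assoc[symmetric] intro: peirce_mult)
    then show "c * b \<in> I" using C_comm[of c b] c b by (simp add: I_def)
  qed (auto simp: I_def C0 C_add C_scale distrib_left scale_mult_right)
  moreover have "defect h m t \<in> I"
    using defect_centre(2)[OF m t] defect_centre(2)[OF peirce_mult[OF _ m] t]
    by (auto simp: I_def C_def defect_ideal[symmetric] m t)
  ultimately show ?thesis using no_ideal by blast
qed

text \<open>The hypothesis on \<open>m\<^sub>0\<close> says that, among the corner components of central elements, \<open>m\<^sub>0\<close> detects
  those which are not central in \<open>\<A>\<close>. Since \<open>m\<^sub>0\<close> is its own partner in \<open>defect_alternating\<close>, two-torsion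
  freeness gives \<open>defect h m\<^sub>0 t m\<^sub>0 = 0\<close>, hence \<open>defect h m\<^sub>0 t = 0\<close>; exchanging \<open>m\<close> and \<open>m\<^sub>0\<close> reduces the general
  case to this one.\<close>

lemma defect_zero_of_separating:
  assumes two: "\<And>x::'a. 2 * x = 0 \<Longrightarrow> x = 0"
    and m\<^sub>0: "m\<^sub>0 \<in> peirce e f"
    and sep: "\<And>a. a \<in> (\<lambda>z. e * z * e) ` centre UNIV \<Longrightarrow> a * m\<^sub>0 = 0 \<Longrightarrow> a \<in> centre UNIV"
    and m: "m \<in> peirce e f" and t: "t \<in> peirce f e"
  shows "defect h m t = 0"
proof -
  have zero: "defect h m' t = 0" if m': "m' \<in> peirce e f" and "defect h m' t * m\<^sub>0 = 0" for m'
    using sep[OF defect_centre(1)[OF m' t]] that central_corner_zero defect_ef_fe[OF m' t] by blast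
  have "2 * (defect h m\<^sub>0 t * m\<^sub>0) = 0"
    using defect_alternating[OF m\<^sub>0 t m\<^sub>0] by (simp add: mult_2 eq_neg_iff_add_eq_0)
  then have "defect h m\<^sub>0 t * m\<^sub>0 = 0" by (rule two)
  then have "defect h m\<^sub>0 t = 0" by (rule zero[OF m\<^sub>0])
  then have "defect h m t * m\<^sub>0 = 0" using defect_alternating[OF m t m\<^sub>0] by simp
  then show ?thesis by (rule zero[OF m])
qed

text \<open>Where no earlier lemma applies, the product of the two Peirce components is zero and \<open>h\<close> respects the
  reason for it.\<close>

lemma defect_row_e:
  assumes off: "\<And>m t. m \<in> peirce e f \<Longrightarrow> t \<in> peirce f e \<Longrightarrow> defect h m t = 0"
  shows "defect h (e * x * e) y = 0" "defect h (e * x * f) y = 0"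
proof -
  have orth: "defect h a b = 0" if "a * b = 0" "h a * b = 0" "a * h b = 0" for a b
    using that by (simp add: defect_def h_simps)
  have 1: "defect h a b = 0" if a: "a \<in> peirce e e" and b: "b \<in> peirce f e \<or> b \<in> peirce f f" for a b
    using b orthogonal_mult(1)[OF a] orthogonal_mult(1)[OF h_ee[OF a]] h_fe h_ff
    by (intro orth) blast+
  have 2: "defect h a b = 0" if a: "a \<in> peirce e f" and b: "b \<in> peirce e e \<or> b \<in> peirce e f" for a b
    using b orthogonal_mult(2)[OF a] orthogonal_mult(2)[OF h_ef[OF a]] h_ee h_ef
    by (intro orth) blast+
  note in_peirce[of e _ e, simp] in_peirce[of e _ f, simp] in_peirce[of f _ e, simp]
    in_peirce[of f _ f, simp]
  show "defect h (e * x * e) y = 0"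
    by (subst decompose[of y]) (simp add: defect_add 1 defect_ee_ee defect_ee_ef)
  show "defect h (e * x * f) y = 0"
    by (subst decompose[of y]) (simp add: defect_add 2 off defect_ef_ff)
qed

lemma derivation_of_off_diagonal:
  assumes off: "\<And>m t. m \<in> peirce e f \<Longrightarrow> t \<in> peirce f e \<Longrightarrow> defect h m t = 0"
  shows "derivation scale h"
proof -
  interpret sw: peirce_derivation scale f e h by (rule swap_derivation)
  have off': "defect h t m = 0" if "t \<in> peirce f e" "m \<in> peirce e f" for t m
    using defect_fe_ef_zero[OF off that(2,1)] .
  have "defect h x y = 0" for x y
    by (subst decompose[of x]) (simp add: defect_add defect_row_e[OF off] sw.defect_row_e[OF off'])
  then show ?thesis
    unfolding derivation_def using linear by (simp add: defect_def algebra_simps)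
qed

text \<open>The descriptions of the centre by \<open>m\<^sub>0\<close> or \<open>t\<^sub>0\<close> both are instances of \<open>defect_zero_of_separating\<close>, for
  \<open>(e, f)\<close> and \<open>(f, e)\<close>: take the other component of the central element to be zero.\<close>

lemma derivation_of_centre_conditions:
  assumes two: "\<And>x::'a. 2 * x = 0 \<Longrightarrow> x = 0"
    and ii: "((\<forall>I. central_ideal scale (peirce e e) I \<longrightarrow> I = {0}) \<or>
              (\<forall>I. central_ideal scale (peirce f f) I \<longrightarrow> I = {0}))
          \<or> (\<exists>m\<^sub>0\<in>peirce e f. centre UNIV =
               {a + b | a b. a \<in> (\<lambda>z. e * z * e) ` centre UNIV \<and>
                             b \<in> (\<lambda>z. f * z * f) ` centre UNIV \<and> a * m\<^sub>0 = m\<^sub>0 * b})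
          \<or> (\<exists>t\<^sub>0\<in>peirce f e. centre UNIV =
               {a + b | a b. a \<in> (\<lambda>z. e * z * e) ` centre UNIV \<and>
                             b \<in> (\<lambda>z. f * z * f) ` centre UNIV \<and> t\<^sub>0 * a = b * t\<^sub>0})
          \<or> ({m * t | m t. m \<in> peirce e f \<and> t \<in> peirce f e} = {0} \<and>
             {t * m | t m. t \<in> peirce f e \<and> m \<in> peirce e f} = {0})"
  shows "derivation scale h"
proof -
  interpret sw: peirce_derivation scale f e h by (rule swap_derivation)
  have zero_image: "0 \<in> (\<lambda>z. p * z * p) ` centre UNIV" for p :: 'a
    using centre_zero by (auto simp: image_iff intro!: bexI[of _ 0])
  from ii show ?thesis
  proof (elim disjE bexE conjE)
    assume "\<forall>I. central_ideal scale (peirce e e) I \<longrightarrow> I = {0}"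
    then show ?thesis by (intro derivation_of_off_diagonal defect_zero_of_no_central_ideal)
  next
    assume "\<forall>I. central_ideal scale (peirce f f) I \<longrightarrow> I = {0}"
    then show ?thesis by (intro sw.derivation_of_off_diagonal sw.defect_zero_of_no_central_ideal)
  next
    fix m\<^sub>0
    assume m\<^sub>0: "m\<^sub>0 \<in> peirce e f" and Z: "centre UNIV =
        {a + b | a b. a \<in> (\<lambda>z. e * z * e) ` centre UNIV \<and>
                      b \<in> (\<lambda>z. f * z * f) ` centre UNIV \<and> a * m\<^sub>0 = m\<^sub>0 * b}"
    have "a \<in> centre UNIV" if "a \<in> (\<lambda>z. e * z * e) ` centre UNIV" "a * m\<^sub>0 = 0" for a
      by (subst Z, intro CollectI exI[of _ "a"] exI[of _ "0"]) (use that zero_image[of f] in simp)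
    then show ?thesis
      by (intro derivation_of_off_diagonal) (rule defect_zero_of_separating[OF two m\<^sub>0])
  next
    fix t\<^sub>0
    assume t\<^sub>0: "t\<^sub>0 \<in> peirce f e" and Z: "centre UNIV =
        {a + b | a b. a \<in> (\<lambda>z. e * z * e) ` centre UNIV \<and>
                      b \<in> (\<lambda>z. f * z * f) ` centre UNIV \<and> t\<^sub>0 * a = b * t\<^sub>0}"
    have "b \<in> centre UNIV" if "b \<in> (\<lambda>z. f * z * f) ` centre UNIV" "b * t\<^sub>0 = 0" for b
      by (subst Z, intro CollectI exI[of _ "0"] exI[of _ "b"]) (use that zero_image[of e] in simp)
    then show ?thesis
      by (intro sw.derivation_of_off_diagonal) (rule sw.defect_zero_of_separating[OF two t\<^sub>0])
  next
    assume *: "{m * t | m t. m \<in> peirce e f \<and> t \<in> peirce f e} = {0}"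
    have "m * t = 0" if "m \<in> peirce e f" "t \<in> peirce f e" for m t
      using * that by blast
    then have "defect h m t = 0" if "m \<in> peirce e f" "t \<in> peirce f e" for m t
      using that by (simp add: defect_def h_simps h_ef h_fe)
    then show ?thesis by (rule derivation_of_off_diagonal)
  qed
qed

end


section \<open>Lie n-derivations for even n\<close>

context faithful_peirce
begin

lemma ad_e_ef: "m \<in> peirce e f \<Longrightarrow> commutator m e = - m"
  using peirce_zeros(4)[of m e] by (simp add: commutator_def peirce_iff)

lemma ad_e_fe: "t \<in> peirce f e \<Longrightarrow> commutator t e = t"
  using peirce_zeros(2)[of t e] by (simp add: commutator_def peirce_iff)

lemma ad_e_cubed: "commutator (commutator (commutator x e) e) e = commutator x e"
  by (simp add: commutator_def algebra_simps idem idem_assoc)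

lemma funpow_ad_e_odd: "((\<lambda>y. commutator y e) ^^ Suc (2 * j)) x = commutator x e"
  by (induction j) (simp_all add: ad_e_cubed)

lemma funpow_ad_e_even:
  "w \<in> peirce e f \<or> w \<in> peirce f e \<Longrightarrow> ((\<lambda>y. commutator y e) ^^ (2 * j)) w = w"
  by (induction j) (auto simp: ad_e_ef ad_e_fe commutator_simps)

text \<open>An instance of the Jacobi identity: \<open>y \<mapsto> [y, e]\<close> and \<open>y \<mapsto> [y, c]\<close> commute when \<open>e\<close> and \<open>c\<close> do.\<close>

lemma commutator_right_swap:
  assumes c: "c * e = e * c"
  shows "commutator (commutator x c) e = commutator (commutator x e) c"
proof -
  have "c * (e * y) = e * (c * y)" for y by (simp add: c mult.assoc[symmetric])
  then show ?thesis by (simp add: commutator_def algebra_simps c)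
qed

end

text \<open>A Lie \<open>n\<close>-derivation with \<open>n = 2 j + 2\<close> that is normalized by the subtraction of an inner
  derivation.\<close>

locale even_lie_derivation = unital_algebra scale + faithful_peirce e f
  for scale :: "'r::comm_ring_1 \<Rightarrow> 'a::ring_1 \<Rightarrow> 'a" and e f :: 'a +
  fixes \<delta> :: "'a \<Rightarrow> 'a" and j :: nat
  assumes linear: "module_hom scale scale \<delta>"
    and leibniz: "\<delta> (lie_poly (Suc (Suc (2 * j))) s) = leibniz_sum \<delta> (Suc (Suc (2 * j))) s"
    and two: "2 * x = 0 \<Longrightarrow> x = (0::'a)"
    and torsion: "of_nat (Suc (2 * j)) * x = 0 \<Longrightarrow> x = (0::'a)"
    and \<delta>_e: "\<delta> e \<in> peirce_diag e f"
begin

lemmas \<delta>_simps = module_hom.add[OF linear] module_hom.neg[OF linear] module_hom.diff[OF linear]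
  module_hom.zero[OF linear]

text \<open>Evaluate the Leibniz sum at \<open>(w, e, \<dots>, e)\<close>. Each of the \<open>n - 1\<close> places filled with \<open>e\<close> contributes the same
  term \<open>[w, \<delta> e]\<close>: the commutator with \<open>\<delta> e\<close> commutes with the remaining \<open>n - 2\<close> commutators with \<open>e\<close>, and
  these, being even in number, act as the identity.\<close>

lemma leibniz_off_diagonal:
  assumes w: "commutator (commutator w e) e = w"
  shows "\<delta> (commutator w e) =
    commutator (\<delta> w) e + of_nat (Suc (2 * j)) * commutator w (\<delta> e)"
proof -
  let ?s = "\<lambda>i::nat. if i = 1 then w else e"
  have c: "\<delta> e * e = e * \<delta> e" using \<delta>_e by (simp add: diag_iff_commute)
  have ad_of_nat: "commutator (of_nat k * x) e = of_nat k * commutator x e" for k x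
  proof -
    have "e * (of_nat k * x) = of_nat k * (e * x)" by (metis mult.assoc mult_of_nat_commute)
    then show ?thesis by (simp add: commutator_def right_diff_distrib mult.assoc)
  qed
  have ad_two: "commutator (2 * x) e = 2 * commutator x e" for x
    using ad_of_nat[of 2 x] by simp
  have "lie_poly (Suc (Suc (2 * i))) ?s = commutator w e \<and>
      leibniz_sum \<delta> (Suc (Suc (2 * i))) ?s =
        commutator (\<delta> w) e + of_nat (Suc (2 * i)) * commutator w (\<delta> e)" for i
  proof (induction i)
    case (Suc i)
    then show ?case
      by (simp add: leibniz_sum_Suc commutator_simps ad_of_nat ad_two ad_e_cubed w
          commutator_right_swap[OF c] algebra_simps)
  qed (simp add: leibniz_sum_Suc leibniz_sum_1)
  from this[of j] show ?thesis using leibniz[of ?s] by simp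
qed

text \<open>On \<open>M\<close> the map \<open>[\<cdot>, e]\<close> is \<open>-1\<close> and on \<open>T\<close> it is \<open>1\<close>. In \<open>leibniz_off_diagonal\<close> for \<open>w = m\<close>, the diagonal
  components of \<open>\<delta> m\<close> are killed on the right-hand side, the component in \<open>T\<close> equals its own negative,
  and in \<open>M\<close> only \<open>(n - 1) [m, \<delta> e]\<close> remains.\<close>

lemma \<delta>_preserves_ef:
  assumes m: "m \<in> peirce e f"
  shows "\<delta> m \<in> peirce e f" "commutator (\<delta> e) m = 0"
proof -
  let ?K = "commutator m (\<delta> e)"
  have K: "?K \<in> peirce e f"
    unfolding commutator_def
    using m diag_mult_peirce[OF \<delta>_e] faithful_peirce.diag_mult_peirce[OF swap, of "\<delta> e"] \<delta>_e
    by (auto intro!: peirce_diff simp: peirce_diag_commute)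
  have K': "f * ?K = 0" "?K * e = 0" "e * ?K = ?K" "?K * f = ?K"
    using K peirce_zeros(1)[OF K] peirce_zeros(4)[OF K] by (simp_all add: peirce_iff)
  have E: "- \<delta> m = \<delta> m * e - e * \<delta> m + of_nat (Suc (2 * j)) * ?K"
    using leibniz_off_diagonal[of m]
    by (simp add: ad_e_ef m commutator_simps \<delta>_simps commutator_def[of "\<delta> m"] del: of_nat_Suc)
  have NK: "p * (of_nat k * ?K) * q = of_nat k * (p * ?K * q)" for p q k
    by (metis mult.assoc mult_of_nat_commute)
  have E': "- (p * \<delta> m * q) = p * (\<delta> m * e - e * \<delta> m) * q + of_nat (Suc (2 * j)) * (p * ?K * q)" for p q
    using arg_cong[OF E, of "\<lambda>x. p * x * q"] by (simp add: NK distrib_left distrib_right del: of_nat_Suc)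
  have "e * \<delta> m * e = 0" using E'[of e e]
    by (simp add: K' algebra_simps idem idem_assoc del: of_nat_Suc)
  moreover have "f * \<delta> m * f = 0" using E'[of f f]
    by (simp add: K' algebra_simps idem idem_assoc del: of_nat_Suc)
  moreover have "f * \<delta> m * e = 0"
  proof (rule two)
    show "2 * (f * \<delta> m * e) = 0"
      using E'[of f e]
      by (simp add: K' algebra_simps idem idem_assoc mult_2 eq_neg_iff_add_eq_0 neg_eq_iff_add_eq_0 del: of_nat_Suc)
  qed
  ultimately have "\<delta> m = e * \<delta> m * f" using decompose[of "\<delta> m"] by simp
  then show "\<delta> m \<in> peirce e f" using in_peirce[of e "\<delta> m" f] by simp
  have "?K = 0"
  proof (rule torsion)
    show "of_nat (Suc (2 * j)) * ?K = 0"
      using E'[of e f] by (simp add: K' algebra_simps idem idem_assoc del: of_nat_Suc)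
  qed
  then show "commutator (\<delta> e) m = 0" by (simp add: commutator_def)
qed

text \<open>The same comparison on \<open>T\<close>, with opposite signs.\<close>

lemma \<delta>_preserves_fe:
  assumes t: "t \<in> peirce f e"
  shows "\<delta> t \<in> peirce f e" "commutator (\<delta> e) t = 0"
proof -
  let ?K = "commutator t (\<delta> e)"
  have K: "?K \<in> peirce f e"
    unfolding commutator_def
    using t diag_mult_peirce[OF \<delta>_e] faithful_peirce.diag_mult_peirce[OF swap, of "\<delta> e"] \<delta>_e
    by (auto intro!: peirce_diff simp: peirce_diag_commute)
  have K': "e * ?K = 0" "?K * f = 0" "f * ?K = ?K" "?K * e = ?K"
    using K peirce_zeros(2)[OF K] peirce_zeros(3)[OF K] by (simp_all add: peirce_iff)
  have E: "\<delta> t = \<delta> t * e - e * \<delta> t + of_nat (Suc (2 * j)) * ?K"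
    using leibniz_off_diagonal[of t]
    by (simp add: ad_e_fe t commutator_simps \<delta>_simps commutator_def[of "\<delta> t"] del: of_nat_Suc)
  have NK: "p * (of_nat k * ?K) * q = of_nat k * (p * ?K * q)" for p q k
    by (metis mult.assoc mult_of_nat_commute)
  have E': "p * \<delta> t * q = p * (\<delta> t * e - e * \<delta> t) * q + of_nat (Suc (2 * j)) * (p * ?K * q)" for p q
    using arg_cong[OF E, of "\<lambda>x. p * x * q"] by (simp add: NK distrib_left distrib_right del: of_nat_Suc)
  have "e * \<delta> t * e = 0" using E'[of e e]
    by (simp add: K' algebra_simps idem idem_assoc del: of_nat_Suc)
  moreover have "f * \<delta> t * f = 0" using E'[of f f]
    by (simp add: K' algebra_simps idem idem_assoc del: of_nat_Suc)
  moreover have "e * \<delta> t * f = 0"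
  proof (rule two)
    show "2 * (e * \<delta> t * f) = 0"
      using E'[of e f]
      by (simp add: K' algebra_simps idem idem_assoc mult_2 eq_neg_iff_add_eq_0 neg_eq_iff_add_eq_0 del: of_nat_Suc)
  qed
  ultimately have "\<delta> t = f * \<delta> t * e" using decompose[of "\<delta> t"] by simp
  then show "\<delta> t \<in> peirce f e" using in_peirce[of f "\<delta> t" e] by simp
  have "?K = 0"
  proof (rule torsion)
    show "of_nat (Suc (2 * j)) * ?K = 0"
      using E'[of f e] by (simp add: K' algebra_simps idem idem_assoc del: of_nat_Suc)
  qed
  then show "commutator (\<delta> e) t = 0" by (simp add: commutator_def)
qed

lemma \<delta>_e_central: "\<delta> e \<in> centre UNIV"
  by (intro diag_central \<delta>_e \<delta>_preserves_ef \<delta>_preserves_fe)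

text \<open>Now that \<open>\<delta> e\<close> is central, the padding lemmas apply; the number \<open>2 j + 1\<close> of commutators with \<open>e\<close> is odd.\<close>

lemma \<delta>_ad_e: "\<delta> (commutator x e) = commutator (\<delta> x) e"
proof -
  let ?s = "\<lambda>i::nat. if i = 1 then x else e"
  have "lie_poly (Suc 0 + Suc (2 * j)) ?s = commutator x e"
    by (subst lie_poly_tail[where c = e]) (simp_all only: funpow_ad_e_odd, simp_all)
  moreover have "leibniz_sum \<delta> (Suc 0 + Suc (2 * j)) ?s = commutator (\<delta> x) e"
    by (subst leibniz_sum_tail[where c = e])
      (simp_all only: funpow_ad_e_odd leibniz_sum_1 \<delta>_e_central, simp_all)
  ultimately show ?thesis using leibniz[of ?s] by simp
qed

lemma \<delta>_preserves_diag: "x \<in> peirce_diag e f \<Longrightarrow> \<delta> x \<in> peirce_diag e f"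
  using \<delta>_ad_e[of x] by (simp add: commutator_def diag_iff_commute \<delta>_simps)

text \<open>The identity of length \<open>n\<close> at \<open>(x, y, e, \<dots>, e)\<close>, in which the \<open>2 j\<close> final commutators with \<open>e\<close> do nothing to
  elements of \<open>M\<close> and of \<open>T\<close>.\<close>

lemma \<delta>_commutator:
  assumes "commutator x y \<in> peirce e f \<or> commutator x y \<in> peirce f e"
    and "commutator (\<delta> x) y + commutator x (\<delta> y) \<in> peirce e f \<or>
      commutator (\<delta> x) y + commutator x (\<delta> y) \<in> peirce f e"
  shows "\<delta> (commutator x y) = commutator (\<delta> x) y + commutator x (\<delta> y)"
proof -
  let ?s = "\<lambda>i::nat. if i = 1 then x else if i = 2 then y else e"
  have "lie_poly (Suc (Suc 0) + 2 * j) ?s = commutator x y"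
    by (subst lie_poly_tail[where c = e]) (auto simp: funpow_ad_e_even assms(1))
  moreover have "leibniz_sum \<delta> (Suc (Suc 0) + 2 * j) ?s = commutator (\<delta> x) y + commutator x (\<delta> y)"
    by (subst leibniz_sum_tail[where c = e])
      (auto simp: funpow_ad_e_even assms(2) leibniz_sum_Suc leibniz_sum_1 \<delta>_e_central)
  ultimately show ?thesis using leibniz[of ?s] by simp
qed

text \<open>Here \<open>[m, t]\<close> is diagonal and would be killed by a subsequent \<open>e\<close>, so the padding stands between \<open>m\<close> and
  \<open>t\<close>.\<close>

lemma \<delta>_commutator_ef_fe:
  assumes m: "m \<in> peirce e f" and t: "t \<in> peirce f e"
  shows "\<delta> (commutator m t) = commutator (\<delta> m) t + commutator m (\<delta> t)"
proof -
  let ?s = "\<lambda>i. if i = Suc (Suc (2 * j)) then t else if i = 1 then m else e"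
  have "lie_poly (Suc 0 + 2 * j) ?s = m"
    by (subst lie_poly_tail[where c = e]) (auto simp: funpow_ad_e_even m)
  moreover have "leibniz_sum \<delta> (Suc 0 + 2 * j) ?s = \<delta> m"
    by (subst leibniz_sum_tail[where c = e])
      (auto simp: funpow_ad_e_even m \<delta>_preserves_ef leibniz_sum_1 \<delta>_e_central)
  ultimately show ?thesis using leibniz[of ?s] by (simp add: leibniz_sum_Suc)
qed

lemma peirce_lie_map: "peirce_lie_map scale e f \<delta>"
proof
  interpret sw: faithful_peirce f e by (rule swap)
  have ef: "commutator x m \<in> peirce e f"
    if "x \<in> peirce_diag e f" and "m \<in> peirce e f" for x m
    using that diag_mult_peirce sw.diag_mult_peirce
    by (auto simp: commutator_def peirce_diag_commute intro!: peirce_diff)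
  have fe: "commutator x t \<in> peirce f e" if "x \<in> peirce_diag e f" and "t \<in> peirce f e" for x t
    using that diag_mult_peirce sw.diag_mult_peirce
    by (auto simp: commutator_def peirce_diag_commute intro!: peirce_diff)
  show "\<delta> (commutator x m) = commutator (\<delta> x) m + commutator x (\<delta> m)"
    if "x \<in> peirce_diag e f" "m \<in> peirce e f" for x m
    using that by (intro \<delta>_commutator disjI1 peirce_add ef \<delta>_preserves_diag \<delta>_preserves_ef peirce_zero)
  show "\<delta> (commutator x t) = commutator (\<delta> x) t + commutator x (\<delta> t)"
    if "x \<in> peirce_diag e f" "t \<in> peirce f e" for x t
    using that by (intro \<delta>_commutator disjI2 peirce_add fe \<delta>_preserves_diag \<delta>_preserves_fe peirce_zero)
qed (auto simp: module_hom.add[OF linear] module_hom.scale[OF linear] \<delta>_preserves_diag \<delta>_preserves_ef \<delta>_preserves_fe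
    \<delta>_commutator_ef_fe)

end

context peirce_lie_map
begin

lemma derivation_plus_central:
  assumes split: "(\<forall>a\<in>peirce e e. splits \<delta> e a) \<and> (\<forall>b\<in>peirce f f. splits \<delta> f b)"
  obtains \<tau> where "module_hom scale scale \<tau>" "\<And>x. \<tau> x \<in> centre UNIV"
    "peirce_derivation scale e f (\<lambda>x. \<delta> x - \<tau> x)"
proof -
  interpret sw: peirce_lie_map scale f e \<delta> by (rule swap_map)
  obtain \<tau>\<^sub>1 where \<tau>\<^sub>1: "module_hom scale scale \<tau>\<^sub>1" "\<And>x. \<tau>\<^sub>1 x \<in> centre UNIV"
    "\<And>x. \<delta> (e * x * e) - \<tau>\<^sub>1 x \<in> peirce e e" "\<And>x. e * x * e = 0 \<Longrightarrow> \<tau>\<^sub>1 x = 0"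
    using central_part split by blast
  obtain \<tau>\<^sub>2 where \<tau>\<^sub>2: "module_hom scale scale \<tau>\<^sub>2" "\<And>x. \<tau>\<^sub>2 x \<in> centre UNIV"
    "\<And>x. \<delta> (f * x * f) - \<tau>\<^sub>2 x \<in> peirce f f" "\<And>x. f * x * f = 0 \<Longrightarrow> \<tau>\<^sub>2 x = 0"
    using sw.central_part split by blast
  define \<tau> where "\<tau> x = \<tau>\<^sub>1 x + \<tau>\<^sub>2 x" for x
  have \<tau>_lin: "module_hom scale scale \<tau>"
    by unfold_locales (simp_all add: \<tau>_def module_hom.add[OF \<tau>\<^sub>1(1)] module_hom.add[OF \<tau>\<^sub>2(1)]
        module_hom.scale[OF \<tau>\<^sub>1(1)] module_hom.scale[OF \<tau>\<^sub>2(1)] scale_right_distrib)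
  have \<tau>_centre: "\<tau> x \<in> centre UNIV" for x
    unfolding \<tau>_def by (intro centre_add \<tau>\<^sub>1 \<tau>\<^sub>2)
  have \<tau>_off: "\<tau> x = 0" if "x \<in> peirce e f \<or> x \<in> peirce f e" for x
  proof -
    have "e * x * e = 0 \<and> f * x * f = 0"
      using that by (auto simp: peirce_def mult.assoc idem idem_assoc)
    then show ?thesis by (simp add: \<tau>_def \<tau>\<^sub>1(4) \<tau>\<^sub>2(4))
  qed
  have \<tau>_ee: "\<tau> a = \<tau>\<^sub>1 a" "\<delta> a - \<tau>\<^sub>1 a \<in> peirce e e" if "a \<in> peirce e e" for a
    using that \<tau>\<^sub>2(4)[of a] \<tau>\<^sub>1(3)[of a] peirce_zeros(1)[OF that] by (auto simp: \<tau>_def peirce_iff)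
  have \<tau>_ff: "\<tau> b = \<tau>\<^sub>2 b" "\<delta> b - \<tau>\<^sub>2 b \<in> peirce f f" if "b \<in> peirce f f" for b
    using that \<tau>\<^sub>1(4)[of b] \<tau>\<^sub>2(3)[of b] peirce_zeros(2)[OF that] by (auto simp: \<tau>_def peirce_iff)
  define h where "h x = \<delta> x - \<tau> x" for x
  have h_lin: "module_hom scale scale h"
    by unfold_locales (simp_all add: h_def \<delta>_simps module_hom.add[OF \<tau>_lin]
        module_hom.scale[OF linear] module_hom.scale[OF \<tau>_lin] scale_right_diff_distrib)
  have h_off: "h x = \<delta> x" if "x \<in> peirce e f \<or> x \<in> peirce f e" for x
    using \<tau>_off[OF that] by (simp add: h_def)
  have h_ee: "h a \<in> peirce e e" if "a \<in> peirce e e" for a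
    using \<tau>_ee[OF that] by (simp add: h_def)
  have h_ff: "h b \<in> peirce f f" if "b \<in> peirce f f" for b
    using \<tau>_ff[OF that] by (simp add: h_def)
  have ad_h: "commutator (\<delta> x) y = commutator (h x) y" for x y
    by (simp add: h_def commutator_simps centre_commutator[OF \<tau>_centre])
  have "peirce_derivation scale e f h"
  proof
    show "defect h a m = 0" if a: "a \<in> peirce e e" and m: "m \<in> peirce e f" for a m
      using lie_ef[OF ee_diag[OF a] m]
      by (simp add: defect_def ad_h ee_commutator[OF a] ee_commutator[OF h_ee[OF a]] m peirce_ef
          h_off peirce_mult[OF a m])
    show "defect h t a = 0" if a: "a \<in> peirce e e" and t: "t \<in> peirce f e" for a t
      using lie_fe[OF ee_diag[OF a] t]
      by (simp add: defect_def ad_h ee_commutator[OF a] ee_commutator[OF h_ee[OF a]] t peirce_fe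
          h_off peirce_mult[OF t a] \<delta>_simps neg_eq_iff)
    show "defect h b t = 0" if b: "b \<in> peirce f f" and t: "t \<in> peirce f e" for b t
      using lie_fe[OF ff_diag[OF b] t]
      by (simp add: defect_def ad_h sw.ee_commutator[OF b] sw.ee_commutator[OF h_ff[OF b]] t peirce_fe
          h_off peirce_mult[OF b t])
    show "defect h m b = 0" if b: "b \<in> peirce f f" and m: "m \<in> peirce e f" for b m
      using lie_ef[OF ff_diag[OF b] m]
      by (simp add: defect_def ad_h sw.ee_commutator[OF b] sw.ee_commutator[OF h_ff[OF b]] m peirce_ef
          h_off peirce_mult[OF m b] \<delta>_simps neg_eq_iff)
    show "defect h m t - defect h t m \<in> centre UNIV" if m: "m \<in> peirce e f" and t: "t \<in> peirce f e" for m t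
    proof -
      have "defect h m t - defect h t m = h (commutator m t) - (commutator (\<delta> m) t + commutator m (\<delta> t))"
        by (simp add: defect_def commutator_def module_hom.diff[OF h_lin] h_off m t algebra_simps)
      also have "\<dots> = - \<tau> (commutator m t)" by (simp add: h_def lie_ef_fe[OF m t])
      finally show ?thesis by (simp add: centre_uminus \<tau>_centre)
    qed
  qed (auto simp: module_hom.add[OF h_lin] module_hom.scale[OF h_lin] h_ee h_ff h_off peirce_ef peirce_fe)
  then show thesis using that \<tau>_lin \<tau>_centre unfolding h_def by blast
qed

end

theorem corollary2p17:
  fixes scale :: "'r::comm_ring_1 \<Rightarrow> 'a::ring_1 \<Rightarrow> 'a"
    and e f :: 'a and n :: nat
  assumes alg: "unital_algebra scale"
    and n: "n \<ge> 2" "even n"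
    and e: "e * e = e" "e \<noteq> 0" "e \<noteq> 1"
    and f: "f = 1 - e"
    and torsion: "torsion_free 2 TYPE('a)" "torsion_free (n - 1) TYPE('a)"
    and faithful_e: "\<And>x. (\<lambda>m. (e * x * e) * m) ` peirce e f = {0} \<Longrightarrow>
                       (\<lambda>t. t * (e * x * e)) ` peirce f e = {0} \<Longrightarrow> e * x * e = 0"
    and faithful_f: "\<And>x. (\<lambda>m. m * (f * x * f)) ` peirce e f = {0} \<Longrightarrow>
                       (\<lambda>t. (f * x * f) * t) ` peirce f e = {0} \<Longrightarrow> f * x * f = 0"
    and i: "(peirce e e = alg_S scale (peirce e e) \<and> peirce f f = alg_S scale (peirce f f))
          \<or> (peirce e e = alg_S scale (peirce e e) \<and>
             centre (peirce e e) = (\<lambda>z. e * z * e) ` centre UNIV)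
          \<or> (peirce f f = alg_S scale (peirce f f) \<and>
             centre (peirce f f) = (\<lambda>z. f * z * f) ` centre UNIV)
          \<or> (centre (peirce e e) = (\<lambda>z. e * z * e) ` centre UNIV \<and>
             centre (peirce f f) = (\<lambda>z. f * z * f) ` centre UNIV \<and>
             (n \<ge> 3 \<longrightarrow> property_P (peirce e e) \<or> property_P (peirce f f)))"
    and ii: "((\<forall>I. central_ideal scale (peirce e e) I \<longrightarrow> I = {0}) \<or>
              (\<forall>I. central_ideal scale (peirce f f) I \<longrightarrow> I = {0}))
          \<or> (\<exists>m\<^sub>0\<in>peirce e f. centre UNIV =
               {a + b | a b. a \<in> (\<lambda>z. e * z * e) ` centre UNIV \<and>
                             b \<in> (\<lambda>z. f * z * f) ` centre UNIV \<and> a * m\<^sub>0 = m\<^sub>0 * b})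
          \<or> (\<exists>t\<^sub>0\<in>peirce f e. centre UNIV =
               {a + b | a b. a \<in> (\<lambda>z. e * z * e) ` centre UNIV \<and>
                             b \<in> (\<lambda>z. f * z * f) ` centre UNIV \<and> t\<^sub>0 * a = b * t\<^sub>0})
          \<or> ({m * t | m t. m \<in> peirce e f \<and> t \<in> peirce f e} = {0} \<and>
             {t * m | t m. t \<in> peirce f e \<and> m \<in> peirce e f} = {0})"
  shows "\<forall>\<phi>. lie_n_derivation scale n \<phi> \<longrightarrow> standard_lie_n_derivation scale n \<phi>"
proof (intro allI impI)
  fix \<phi>
  assume \<phi>: "lie_n_derivation scale n \<phi>"
  interpret unital_algebra scale by (rule alg)
  have image_zero: "(\<lambda>m. g m) ` peirce p q = {0}" if "\<And>m. m \<in> peirce p q \<Longrightarrow> g m = 0"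
    for g :: "'a \<Rightarrow> 'a" and p q
    using that peirce_zero[of p q] by force
  interpret faithful_peirce e f
  proof
    show "a = 0" if a: "a \<in> peirce e e" and z: "\<And>m. m \<in> peirce e f \<Longrightarrow> a * m = 0"
      "\<And>t. t \<in> peirce f e \<Longrightarrow> t * a = 0" for a
    proof -
      obtain x where x: "a = e * x * e" using a by (auto simp: peirce_def)
      show ?thesis unfolding x by (intro faithful_e image_zero) (use z x in auto)
    qed
    show "b = 0" if b: "b \<in> peirce f f" and z: "\<And>t. t \<in> peirce f e \<Longrightarrow> b * t = 0"
      "\<And>m. m \<in> peirce e f \<Longrightarrow> m * b = 0" for b
    proof -
      obtain x where x: "b = f * x * f" using b by (auto simp: peirce_def)
      show ?thesis unfolding x by (intro faithful_f image_zero) (use z x in auto)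
    qed
  qed (simp_all add: f e algebra_simps)
  obtain j where j: "n = Suc (Suc (2 * j))"
  proof -
    obtain k where "n = 2 * k" using n(2) by blast
    then show thesis using that[of "k - 1"] n(1) by simp
  qed
  have two: "x = 0" if "2 * x = 0" for x :: 'a
    using torsion(1) that by (simp add: torsion_free_def)
  have \<phi>_lin: "module_hom scale scale \<phi>"
    and \<phi>_leibniz: "\<phi> (lie_poly n s) = leibniz_sum \<phi> n s" for s
    using \<phi> by (simp_all add: lie_n_derivation_def leibniz_sum_def)
  \<comment> \<open>Chosen so that \<open>[e, d]\<close> is the off-diagonal part of \<open>\<phi> e\<close>.\<close>
  define d where "d = e * \<phi> e * f - f * \<phi> e * e"
  define ad where "ad x = commutator x d" for x
  have ad_lin: "module_hom scale scale ad"
    by unfold_locales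
      (simp_all add: ad_def commutator_def algebra_simps scale_mult_left scale_mult_right)
  have ad_mult: "ad (x * y) = ad x * y + x * ad y" for x y
    by (simp add: ad_def commutator_def algebra_simps)
  define \<delta> where "\<delta> x = \<phi> x - ad x" for x
  have \<delta>_lin: "module_hom scale scale \<delta>"
    by unfold_locales
      (simp_all add: \<delta>_def module_hom.add[OF \<phi>_lin] module_hom.add[OF ad_lin]
        module_hom.scale[OF \<phi>_lin] module_hom.scale[OF ad_lin] scale_right_diff_distrib)
  have \<delta>_leibniz: "\<delta> (lie_poly n s) = leibniz_sum \<delta> n s" for s
    unfolding \<delta>_def j leibniz_sum_diff
    using \<phi>_leibniz[of s] leibniz_sum_derivation[OF module_hom.diff[OF ad_lin] ad_mult]
    by (simp add: j)
  interpret even_lie_derivation scale e f \<delta> j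
  proof
    show "x = 0" if "of_nat (Suc (2 * j)) * x = 0" for x :: 'a
      using torsion(2) that by (simp add: torsion_free_def j)
    show "\<delta> e \<in> peirce_diag e f"
      by (simp add: peirce_diag_def \<delta>_def ad_def commutator_def d_def algebra_simps idem idem_assoc)
  qed (use \<delta>_leibniz two in \<open>auto simp: j module_hom.add[OF \<delta>_lin] module_hom.scale[OF \<delta>_lin]\<close>)
  interpret peirce_lie_map scale e f \<delta> by (rule peirce_lie_map)
  \<comment> \<open>For \<open>n = 2\<close> the sum \<open>[\<delta> a, b] + [a, \<delta> b]\<close> is zero, not merely central, so both summands vanish.\<close>
  have n2: "\<forall>a\<in>peirce e e. f * \<delta> a * f \<in> centre (peirce f f)" if "\<not> n \<ge> 3"
  proof
    fix a assume a: "a \<in> peirce e e"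
    interpret sw: peirce_lie_map scale f e \<delta> by (rule swap_map)
    have "commutator (\<delta> a) b = 0" if b: "b \<in> peirce f f" for b
    proof -
      let ?s = "\<lambda>i::nat. if i = 1 then a else b"
      have n: "n = Suc (Suc 0)" using \<open>\<not> n \<ge> 3\<close> \<open>n \<ge> 2\<close> by simp
      have "commutator a b = 0"
        by (simp add: commutator_def orthogonal_mult(1)[OF a b] orthogonal_mult(2)[OF b a])
      then have sum0: "commutator (\<delta> a) b + commutator a (\<delta> b) = 0"
        using \<delta>_leibniz[of ?s] by (simp add: n leibniz_sum_Suc leibniz_sum_1 \<delta>_simps)
      have 1: "commutator (\<delta> a) b \<in> peirce f f"
        using sw.diag_commutator_ee(1)[OF sw.diag[OF sw.ff_diag[OF a]] b] .
      have 2: "commutator a (\<delta> b) \<in> peirce e e"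
        using diag_commutator_ee(2)[OF diag[OF ff_diag[OF b]] a] .
      have "commutator (\<delta> a) b = f * (commutator (\<delta> a) b + commutator a (\<delta> b))"
        using 1 peirce_zeros(1)[OF 2] by (simp add: distrib_left peirce_iff)
      then show ?thesis by (simp add: sum0)
    qed
    then show "f * \<delta> a * f \<in> centre (peirce f f)"
      using sw.corner_in_centre_iff[OF sw.diag[OF sw.ff_diag[OF a]]] by blast
  qed
  have split: "(\<forall>a\<in>peirce e e. splits \<delta> e a) \<and> (\<forall>b\<in>peirce f f. splits \<delta> f b)"
    by (rule corners_split) (use i n2 in argo)
  obtain \<tau> where \<tau>: "module_hom scale scale \<tau>" "\<And>x. \<tau> x \<in> centre UNIV"
    "peirce_derivation scale e f (\<lambda>x. \<delta> x - \<tau> x)"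
    using derivation_plus_central[OF split] by blast
  define h where "h x = \<delta> x - \<tau> x" for x
  have h: "derivation scale h"
    using peirce_derivation.derivation_of_centre_conditions[OF \<tau>(3) two ii] unfolding h_def .
  then have h_lin: "module_hom scale scale h" and h_mult: "h (x * y) = h x * y + x * h y" for x y
    by (simp_all add: derivation_def)
  have \<tau>_eq: "\<tau> = (\<lambda>x. \<delta> x - h x)" by (simp add: h_def)
  have "leibniz_sum \<tau> n s = \<delta> (lie_poly n s) - h (lie_poly n s)" for s
    unfolding \<tau>_eq j leibniz_sum_diff
    using \<delta>_leibniz[of s] leibniz_sum_derivation[OF module_hom.diff[OF h_lin] h_mult]
    by (simp add: j)
  then have "\<tau> (lie_poly n s) = 0" for s
    using leibniz_sum_central[where \<tau> = \<tau>, OF \<tau>(2), where k = "2 * j" and x = s] by (simp add: h_def j)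
  moreover have "module_hom scale scale (\<lambda>x. h x + ad x)"
    by unfold_locales
      (simp_all add: module_hom.add[OF h_lin] module_hom.add[OF ad_lin]
        module_hom.scale[OF h_lin] module_hom.scale[OF ad_lin] scale_right_distrib)
  then have "derivation scale (\<lambda>x. h x + ad x)"
    by (simp add: derivation_def h_mult ad_mult algebra_simps)
  moreover have "\<phi> x = (h x + ad x) + \<tau> x" for x
    by (simp add: h_def \<delta>_def)
  ultimately show "standard_lie_n_derivation scale n \<phi>"
    unfolding standard_lie_n_derivation_def using \<tau>(1,2) by blast
qed

end
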